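(* Let $G$ be a totally disconnected, locally compact group and let $H$ be a closed subgroup of $G$ having finite co-volume. Then for every $x\in G$ there are an integer $n\geq 1$ and an element $h\in H$ such that $$s_G(x)^n = s_G(h),$$ and moreover the subgroup $\mathsf{con}(h)$ is conjugate (in $G$) to $\mathsf{con}(x)$.
   Context: Let $G$ be a (Hausdorff) totally disconnected, locally compact group with identity $e$. A closed subgroup $H$ of $G$ has finite co-volume if the coset space $G/H$ supports a nonzero finite $G$-invariant Radon measure. The scale on $G$ is the function $s_G: G\to\mathbb{Z}^+$ defined by $s_G(x) := \min\{[xVx^{-1}: xVx^{-1}\cap V] : V\leqslant G,\ V \text{ compact and open}\}$. The contraction subgroup for $x\in G$ is $\mathsf{con}(x) := \{g\in G \mid x^n g x^{-n}\to e \text{ as } n\to\infty\}$. For $h\in H$, both $s_G(h)$ and $\mathsf{con}(h)$ are computed in $G$. *)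

theory Defs
  imports "HOL-Analysis.Analysis" "HOL-Algebra.Left_Coset"
begin

locale topological_group = group G for G (structure) +
  fixes T :: "'a topology"
  assumes topspace_carrier: "topspace T = carrier G"
    and continuous_mult: "continuous_map (prod_topology T T) T (\<lambda>(x, y). x \<otimes> y)"
    and continuous_inv: "continuous_map T T (\<lambda>x. inv x)"

definition totally_disconnected_space :: "'a topology \<Rightarrow> bool" where
  "totally_disconnected_space X \<longleftrightarrow>
     (\<forall>S x y. connectedin X S \<longrightarrow> x \<in> S \<longrightarrow> y \<in> S \<longrightarrow> x = y)"

locale tdlc_group = topological_group +
  assumes Hausdorff: "Hausdorff_space T"
    and locally_compact: "locally_compact_space T"
    and totally_disconnected: "totally_disconnected_space T"

definition coset_topology ::
    "('a, 'b) monoid_scheme \<Rightarrow> 'a topology \<Rightarrow> 'a set \<Rightarrow> 'a set topology" where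
  "coset_topology G T H = topology (\<lambda>U. U \<subseteq> lcosets\<^bsub>G\<^esub> H \<and>
     openin T {x \<in> carrier G. x <#\<^bsub>G\<^esub> H \<in> U})"

lemma openin_coset_topology:
  "openin (coset_topology G T H) U \<longleftrightarrow>
     U \<subseteq> lcosets\<^bsub>G\<^esub> H \<and> openin T {x \<in> carrier G. x <#\<^bsub>G\<^esub> H \<in> U}"
proof -
  let ?P = "\<lambda>U. {x \<in> carrier G. x <#\<^bsub>G\<^esub> H \<in> U}"
  have "istopology (\<lambda>U. U \<subseteq> lcosets\<^bsub>G\<^esub> H \<and> openin T (?P U))"
    unfolding istopology_def
  proof (intro conjI allI impI)
    fix S U assume "S \<subseteq> lcosets\<^bsub>G\<^esub> H \<and> openin T (?P S)" "U \<subseteq> lcosets\<^bsub>G\<^esub> H \<and> openin T (?P U)"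
    moreover have "?P (S \<inter> U) = ?P S \<inter> ?P U" by auto
    ultimately show "S \<inter> U \<subseteq> lcosets\<^bsub>G\<^esub> H" "openin T (?P (S \<inter> U))" by auto
  next
    fix K assume "\<forall>U\<in>K. U \<subseteq> lcosets\<^bsub>G\<^esub> H \<and> openin T (?P U)"
    moreover have "?P (\<Union>K) = (\<Union>U\<in>K. ?P U)" by auto
    ultimately show "\<Union>K \<subseteq> lcosets\<^bsub>G\<^esub> H" "openin T (?P (\<Union>K))" by auto
  qed
  then show ?thesis
    by (simp add: coset_topology_def)
qed

lemma (in topological_group) quotient_map_coset_topology:
  "quotient_map T (coset_topology G T H) (\<lambda>x. x <# H)"
proof -
  have "{x \<in> carrier G. x <# H \<in> lcosets H} = topspace T"
    by (auto simp: LCOSETS_def topspace_carrier)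
  then have "openin (coset_topology G T H) (lcosets H)"
    by (simp add: openin_coset_topology)
  then have "topspace (coset_topology G T H) = lcosets H"
    by (meson openin_coset_topology openin_subset openin_topspace subset_antisym)
  then show ?thesis
    by (auto simp: quotient_map_def topspace_carrier openin_coset_topology LCOSETS_def)
qed

definition borel_of :: "'a topology \<Rightarrow> 'a measure" where
  "borel_of X = sigma (topspace X) {U. openin X U}"

definition radon_measure :: "'a topology \<Rightarrow> 'a measure \<Rightarrow> bool" where
  "radon_measure X \<mu> \<longleftrightarrow>
     sets \<mu> = sets (borel_of X) \<and>
     (\<forall>K. compactin X K \<longrightarrow> emeasure \<mu> K < \<infinity>) \<and>
     (\<forall>A \<in> sets \<mu>. emeasure \<mu> A = (INF U \<in> {U. openin X U \<and> A \<subseteq> U}. emeasure \<mu> U)) \<and>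
     (\<forall>U. openin X U \<longrightarrow> emeasure \<mu> U = (SUP K \<in> {K. compactin X K \<and> K \<subseteq> U}. emeasure \<mu> K))"

definition finite_covolume ::
    "('a, 'b) monoid_scheme \<Rightarrow> 'a topology \<Rightarrow> 'a set \<Rightarrow> bool" where
  "finite_covolume G T H \<longleftrightarrow>
     (\<exists>\<mu>. radon_measure (coset_topology G T H) \<mu> \<and>
       (\<forall>g \<in> carrier G. \<forall>A \<in> sets \<mu>. emeasure \<mu> ((\<lambda>C. g <#\<^bsub>G\<^esub> C) ` A) = emeasure \<mu> A) \<and>
       emeasure \<mu> (space \<mu>) \<noteq> 0 \<and> emeasure \<mu> (space \<mu>) < \<infinity>)"

definition subgroup_index :: "('a, 'b) monoid_scheme \<Rightarrow> 'a set \<Rightarrow> 'a set \<Rightarrow> nat" where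
  "subgroup_index G K L = card (lcosets\<^bsub>G\<lparr>carrier := K\<rparr>\<^esub> L)"

definition conj_set :: "('a, 'b) monoid_scheme \<Rightarrow> 'a \<Rightarrow> 'a set \<Rightarrow> 'a set" where
  "conj_set G x V = (\<lambda>v. x \<otimes>\<^bsub>G\<^esub> v \<otimes>\<^bsub>G\<^esub> inv\<^bsub>G\<^esub> x) ` V"

text \<open>
  For compact open \<open>V\<close> the index below is finite, since \<open>x V x\<inverse>\<close> is compact and the
  intersection is open; so the convention that an infinite set has cardinality 0 never applies.
  In a totally disconnected, locally compact group, compact open subgroups exist
  (van Dantzig), so the minimum exists.
\<close>
definition group_scale :: "('a, 'b) monoid_scheme \<Rightarrow> 'a topology \<Rightarrow> 'a \<Rightarrow> nat" where
  "group_scale G T x = (LEAST m. \<exists>V. subgroup V G \<and> compactin T V \<and> openin T V \<and>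
     m = subgroup_index G (conj_set G x V) (conj_set G x V \<inter> V))"

definition con :: "('a, 'b) monoid_scheme \<Rightarrow> 'a topology \<Rightarrow> 'a \<Rightarrow> 'a set" where
  "con G T x = {g \<in> carrier G.
     limitin T (\<lambda>n::nat. x [^]\<^bsub>G\<^esub> n \<otimes>\<^bsub>G\<^esub> g \<otimes>\<^bsub>G\<^esub> inv\<^bsub>G\<^esub> (x [^]\<^bsub>G\<^esub> n)) \<one>\<^bsub>G\<^esub> sequentially}"

end

theory Submission
  imports Defs
begin

text \<open>
  Every \<open>x\<close> admits a compact open subgroup \<open>V\<close> that is tidy in the sense of Willis. Tidiness makes
  \<open>(V x\<^sup>n V)\<^sup>k = V x\<^bsup>nk\<^esup> V\<close>, and makes the index of \<open>V\<close> in its conjugates multiplicative along powers of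
  \<open>x\<close>; comparing with an arbitrary compact open \<open>U\<close> through \<open>k\<close>-th powers, the scale of any
  \<open>h \<in> V x\<^sup>n V\<close> is the \<open>n\<close>-th power of the scale of \<open>x\<close>. Moreover some \<open>t \<in> V\<close> satisfies
  \<open>h\<^sup>k t \<in> V x\<^bsup>nk\<^esup>\<close> for all \<open>k\<close> simultaneously, so that \<open>t\<close> conjugates the contraction group of \<open>x\<^sup>n\<close>,
  which is that of \<open>x\<close>, onto that of \<open>h\<close>. Finally, the image of \<open>V\<close> in \<open>G/H\<close> has positive measure,
  so Poincare recurrence provides an element of \<open>H\<close> in \<open>V x\<^sup>n V\<close> for some \<open>n \<ge> 1\<close>.
\<close>

section \<open>Topological groups and compact open subgroups\<close>

text \<open>Two obstacles shape the proof. A factorization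
  \<open>V \<subseteq> bwd V <#> fwd V\<close> can be reached by shrinking any compact open
  subgroup, but orbits may still leave \<open>V\<close> and come back much later, and this would
  break both the counting of cosets and the nesting behind the choice of \<open>t\<close>. The
  elements responsible are the homoclinic ones. Shrinking does not remove them in general, so they
  are absorbed into the subgroup, which is possible because their closure is compact. Absorbing them
  may in turn destroy the factorization, so the shrinking is done once more, in a form that keeps
  every flow-invariant subset. The other obstacle is that the scale is a minimum over all compact
  open subgroups. The indices belonging to two subgroups differ at most by a factor that does not
  depend on the group element; along the powers of one element this factor becomes invisible, since
  one index is exactly multiplicative and the other submultiplicative.\<close>

no_notation subset_mset (infix "<#" 50)

context group
begin

lemma inv_mult_cancel [simp]:
  "a \<in> carrier G \<Longrightarrow> b \<in> carrier G \<Longrightarrow> inv a \<otimes> (a \<otimes> b) = b"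
  "a \<in> carrier G \<Longrightarrow> b \<in> carrier G \<Longrightarrow> a \<otimes> (inv a \<otimes> b) = b"
  by (simp_all flip: m_assoc)

lemma set_multI: "a \<in> A \<Longrightarrow> b \<in> B \<Longrightarrow> a \<otimes> b \<in> A <#> B"
  by (auto simp: set_mult_def)

lemma set_multE:
  assumes "g \<in> A <#> B"
  obtains a b where "a \<in> A" "b \<in> B" "g = a \<otimes> b"
  using assms by (auto simp: set_mult_def)

lemma l_coset_eq_iff:
  assumes "subgroup V G" "a \<in> carrier G" "b \<in> carrier G"
  shows "a <# V = b <# V \<longleftrightarrow> inv a \<otimes> b \<in> V"
proof
  assume "a <# V = b <# V"
  then have "b \<in> a <# V" using lcos_self assms by blast
  then show "inv a \<otimes> b \<in> V"
    by (rule subgroup.lcos_module_imp[OF assms(1) group_axioms assms(2)])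
next
  assume "inv a \<otimes> b \<in> V"
  then have "b \<in> a <# V"
    by (rule subgroup.lcos_module_rev[OF assms(1) group_axioms assms(2,3)])
  then show "a <# V = b <# V"
    by (rule l_repr_independence[OF _ assms(2,1)])
qed

end

context topological_group
begin

lemma continuous_map_mult:
  assumes "continuous_map X T f" "continuous_map X T g"
  shows "continuous_map X T (\<lambda>x. f x \<otimes> g x)"
proof -
  have "continuous_map X (prod_topology T T) (\<lambda>x. (f x, g x))"
    using assms by (simp add: continuous_map_pairwise o_def)
  from continuous_map_compose[OF this continuous_mult] show ?thesis
    by (simp add: o_def)
qed

lemma continuous_map_inv:
  assumes "continuous_map X T f"
  shows "continuous_map X T (\<lambda>x. inv f x)"
  using continuous_map_compose[OF assms continuous_inv] by (simp add: o_def)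

lemma continuous_map_const_carrier: "a \<in> carrier G \<Longrightarrow> continuous_map X T (\<lambda>x. a)"
  by (simp add: topspace_carrier)

lemma continuous_map_identity: "continuous_map X X (\<lambda>x. x)"
  using continuous_map_id unfolding id_def .

lemmas continuous_group_intros =
  continuous_map_mult continuous_map_inv continuous_map_const_carrier continuous_map_identity

lemma openin_subset_carrier: "openin T U \<Longrightarrow> U \<subseteq> carrier G"
  using openin_subset topspace_carrier by metis

lemma compactin_subset_carrier: "compactin T K \<Longrightarrow> K \<subseteq> carrier G"
  using compactin_subset_topspace topspace_carrier by metis

lemma openin_preimage:
  assumes "continuous_map T T f" "openin T U"
  shows "openin T {g \<in> carrier G. f g \<in> U}"
  using openin_continuous_map_preimage[OF assms] by (simp add: topspace_carrier)

lemma closedin_preimage: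
  assumes "continuous_map T T f" "closedin T U"
  shows "closedin T {g \<in> carrier G. f g \<in> U}"
  using closedin_continuous_map_preimage[OF assms] by (simp add: topspace_carrier)

lemma openin_l_coset:
  assumes "a \<in> carrier G" "openin T U"
  shows "openin T (a <# U)"
proof -
  have "a <# U = {g \<in> carrier G. inv a \<otimes> g \<in> U}"
  proof (intro equalityI subsetI)
    fix g assume "g \<in> a <# U"
    then obtain u where "u \<in> U" "g = a \<otimes> u" by (auto simp: l_coset_def)
    then show "g \<in> {g \<in> carrier G. inv a \<otimes> g \<in> U}"
      using assms openin_subset_carrier[OF assms(2)] by auto
  next
    fix g assume "g \<in> {g \<in> carrier G. inv a \<otimes> g \<in> U}"
    then show "g \<in> a <# U"
      using assms by (auto simp: l_coset_def intro!: bexI[of _ "inv a \<otimes> g"])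
  qed
  moreover have "openin T {g \<in> carrier G. inv a \<otimes> g \<in> U}"
    by (intro openin_preimage assms continuous_group_intros inv_closed)
  ultimately show ?thesis by simp
qed

lemma openin_set_mult:
  assumes "S \<subseteq> carrier G" "openin T U"
  shows "openin T (S <#> U)"
proof -
  have "S <#> U = (\<Union>s\<in>S. s <# U)" by (auto simp: set_mult_def l_coset_def)
  moreover have "openin T (\<Union>s\<in>S. s <# U)" using openin_l_coset assms by blast
  ultimately show ?thesis by simp
qed

lemma compactin_set_mult:
  assumes "compactin T K" "compactin T L"
  shows "compactin T (K <#> L)"
proof -
  have "K <#> L = (\<lambda>(x, y). x \<otimes> y) ` (K \<times> L)" by (auto simp: set_mult_def)
  moreover have "compactin T ((\<lambda>(x, y). x \<otimes> y) ` (K \<times> L))"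
    by (rule image_compactin[OF _ continuous_mult]) (simp add: compactin_Times assms)
  ultimately show ?thesis by simp
qed

text \<open>The finite cover is taken for the compact \<open>K\<close>; each coset in it that meets
  \<open>A\<close> is then renamed after a point of \<open>A\<close>. So \<open>A\<close> may be any
  subset, and the representatives inherit its properties.\<close>

lemma compactin_cover_cosets:
  assumes K: "compactin T K" and V: "subgroup V G" "openin T V" and A: "A \<subseteq> K"
  obtains F where "finite F" "F \<subseteq> A" "A \<subseteq> F <#> V"
proof -
  have Kc: "K \<subseteq> carrier G" using K compactin_subset_carrier by blast
  let ?U = "(\<lambda>k. k <# V) ` K"
  have "K \<subseteq> \<Union>?U" using lcos_self[OF _ V(1)] Kc by blast
  moreover have "\<And>U. U \<in> ?U \<Longrightarrow> openin T U" using openin_l_coset V(2) Kc by blast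
  ultimately obtain \<F> where F: "finite \<F>" "\<F> \<subseteq> ?U" "K \<subseteq> \<Union>\<F>"
    using compactinD[OF K, of ?U] by blast
  define r where "r = (\<lambda>C. SOME a. a \<in> A \<inter> C)"
  have r: "r C \<in> A \<inter> C" if "A \<inter> C \<noteq> {}" for C
    unfolding r_def using that by (metis ex_in_conv someI_ex)
  let ?F = "r ` {C \<in> \<F>. A \<inter> C \<noteq> {}}"
  have "A \<subseteq> ?F <#> V"
  proof
    fix a assume a: "a \<in> A"
    then obtain C where C: "C \<in> \<F>" "a \<in> C" using F A by blast
    then obtain k where k: "k \<in> K" "C = k <# V" using F by blast
    have rC: "r C \<in> A \<inter> C" using r[of C] a C by blast
    then have "C = r C <# V" using l_repr_independence[of "r C" k V] k V Kc by blast
    then have "a \<in> r C <# V" using C by simp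
    then obtain v where "v \<in> V" "a = r C \<otimes> v" by (auto simp: l_coset_def)
    then show "a \<in> ?F <#> V" using a C by (auto intro!: set_multI)
  qed
  moreover have "?F \<subseteq> A" using r by blast
  moreover have "finite ?F" using F(1) by simp
  ultimately show ?thesis by (intro that[of ?F])
qed

lemma subgroup_closure_of:
  assumes "subgroup D G"
  shows "subgroup (T closure_of D) G"
proof (rule subgroupI)
  have D: "D \<subseteq> topspace T" using subgroup.subset[OF assms] topspace_carrier by simp
  show "T closure_of D \<subseteq> carrier G"
    using closure_of_subset_topspace topspace_carrier by metis
  show "T closure_of D \<noteq> {}"
    using closure_of_subset[OF D] subgroup.one_closed[OF assms] by blast
  show "inv a \<in> T closure_of D" if "a \<in> T closure_of D" for a
  proof -
    have "(\<lambda>x. inv x) ` D \<subseteq> D" using subgroup.m_inv_closed[OF assms] by blast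
    then have "(\<lambda>x. inv x) ` (T closure_of D) \<subseteq> T closure_of D"
      using continuous_map_image_closure_subset[OF continuous_inv, of D] closure_of_mono by blast
    then show ?thesis using that by blast
  qed
  show "a \<otimes> b \<in> T closure_of D" if "a \<in> T closure_of D" "b \<in> T closure_of D" for a b
  proof -
    have "(\<lambda>(x, y). x \<otimes> y) ` (D \<times> D) \<subseteq> D"
      by (auto intro: subgroup.m_closed[OF assms])
    then have "(\<lambda>(x, y). x \<otimes> y) ` (prod_topology T T closure_of (D \<times> D)) \<subseteq> T closure_of D"
      by (rule order_trans[OF continuous_map_image_closure_subset[OF continuous_mult] closure_of_mono])
    moreover have "(a, b) \<in> prod_topology T T closure_of (D \<times> D)"
      using that by (simp add: closure_of_Times)
    ultimately have "(\<lambda>(x, y). x \<otimes> y) (a, b) \<in> T closure_of D" by (blast intro: imageI)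
    then show ?thesis by simp
  qed
qed

lemma closedin_open_subgroup:
  assumes V: "subgroup V G" "openin T V"
  shows "closedin T V"
proof -
  have Vc: "V \<subseteq> carrier G" using subgroup.subset[OF V(1)] .
  have "carrier G - V = (carrier G - V) <#> V"
  proof (intro equalityI subsetI)
    fix g assume g: "g \<in> carrier G - V"
    then have "g \<otimes> \<one> \<in> (carrier G - V) <#> V"
      using subgroup.one_closed[OF V(1)] by (blast intro: set_multI)
    then show "g \<in> (carrier G - V) <#> V" using g by simp
  next
    fix g assume "g \<in> (carrier G - V) <#> V"
    then obtain a v where av: "a \<in> carrier G - V" "v \<in> V" "g = a \<otimes> v" by (rule set_multE)
    have v: "v \<in> carrier G" using av Vc by blast
    have "a \<in> V" if "g \<in> V"
    proof -
      have "g \<otimes> inv v \<in> V"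
        using that av subgroup.m_inv_closed[OF V(1)] subgroup.m_closed[OF V(1)] by blast
      then show ?thesis using av v by (simp add: m_assoc)
    qed
    then show "g \<in> carrier G - V" using av v by auto
  qed
  moreover have "openin T ((carrier G - V) <#> V)" by (rule openin_set_mult) (use V in auto)
  ultimately have "openin T (topspace T - V)" by (simp add: topspace_carrier)
  then show ?thesis using Vc by (simp add: closedin_def topspace_carrier)
qed

definition compact_open_subgroup :: "'a set \<Rightarrow> bool" where
  "compact_open_subgroup V \<longleftrightarrow> subgroup V G \<and> compactin T V \<and> openin T V"

lemma compact_open_subgroupD:
  assumes "compact_open_subgroup V"
  shows "subgroup V G" "compactin T V" "openin T V" "V \<subseteq> carrier G"
  using assms compactin_subset_carrier by (auto simp: compact_open_subgroup_def)

end

text \<open>Cantor's intersection theorem. Every passage below from finitely many times to all times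
  goes through it.\<close>

lemma compactin_nested_nonempty:
  fixes C :: "nat \<Rightarrow> 'a set"
  assumes "compactin X K" "\<And>n. closedin X (C n)" "\<And>n. C n \<subseteq> K" "\<And>n. C n \<noteq> {}"
    and "\<And>n. C (Suc n) \<subseteq> C n"
  obtains x where "\<And>n. x \<in> C n"
proof -
  have "(\<Inter>n. C n) \<noteq> {}"
  proof (rule compact_space_imp_nest[of "subtopology X K"])
    show "compact_space (subtopology X K)" using assms compact_space_subtopology by blast
    show "closedin (subtopology X K) (C n)" for n
      using assms by (meson closedin_subset_topspace)
    show "decseq C" using assms(5) by (simp add: decseq_Suc_iff)
  qed (use assms in auto)
  then show ?thesis using that by blast
qed

context tdlc_group
begin

lemma compact_imp_closed: "compactin T K \<Longrightarrow> closedin T K"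
  using Hausdorff compactin_imp_closedin by blast

text \<open>The subgroup is the right stabilizer of a compact open neighbourhood of the identity.\<close>
lemma exists_compact_open_subgroup: "\<exists>V. compact_open_subgroup V"
proof -
  have one: "\<one> \<in> topspace T" by (simp add: topspace_carrier)
  let ?C = "connected_component_of_set T \<one>"
  have C: "?C = {\<one>}"
  proof -
    have "\<one> \<in> ?C" using one connected_component_of_refl by fastforce
    moreover have "connectedin T ?C" by (rule connectedin_connected_component_of)
    ultimately show ?thesis
      using totally_disconnected unfolding totally_disconnected_space_def by blast
  qed
  obtain U0 K0 where U0: "openin T U0" "compactin T K0" "\<one> \<in> U0" "U0 \<subseteq> K0"
    using locally_compact one unfolding locally_compact_space_def by blast
  \<comment> \<open>Wilder's theorem encloses the component of the identity, here a single point, in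
    a clopen set inside \<open>U0\<close>.\<close>
  obtain K B where KB: "openin T K" "openin T B" "disjnt K B"
    "K \<union> B = topspace T" "?C \<subseteq> K" "K \<subseteq> U0"
  proof (rule wilder_locally_compact_component_thm[OF locally_compact Hausdorff, of ?C U0])
    show "?C \<in> connected_components_of T"
      using one by (simp add: connected_component_in_connected_components_of)
    show "compactin T ?C" using C one by simp
    show "openin T U0" "?C \<subseteq> U0" using C U0 by simp_all
  qed
  have "topspace T - K = B" using KB(3,4) by (auto simp: disjnt_iff)
  then have "closedin T K" using KB(1,2) openin_subset by (auto simp: closedin_def)
  then have K: "compactin T K" using closed_compactin[OF U0(2)] KB(6) U0(4) by blast
  have Kc: "K \<subseteq> carrier G" using K compactin_subset_carrier by blast
  let ?S = "{g \<in> carrier G. \<forall>k\<in>K. k \<otimes> g \<in> K}"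
  have S: "openin T ?S"
  proof (subst openin_subopen, clarify)
    fix g assume g: "g \<in> carrier G" "\<forall>k\<in>K. k \<otimes> g \<in> K"
    let ?W = "{z \<in> topspace (prod_topology T T). (\<lambda>(x, y). x \<otimes> y) z \<in> K}"
    have "openin (prod_topology T T) ?W"
      using openin_continuous_map_preimage[OF continuous_mult KB(1)] .
    moreover have "K \<times> {g} \<subseteq> ?W" using g Kc by (auto simp: topspace_carrier)
    ultimately obtain U V where UV: "openin T U" "openin T V" "K \<subseteq> U" "g \<in> V" "U \<times> V \<subseteq> ?W"
      using tube_lemma_left[of T T ?W K g] K g by (auto simp: topspace_carrier)
    then have "V \<subseteq> ?S" using openin_subset_carrier by fastforce
    then show "\<exists>V. openin T V \<and> g \<in> V \<and> V \<subseteq> ?S" using UV by blast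
  qed
  \<comment> \<open>Elements of \<open>?S\<close> only map \<open>K\<close> into itself;
    intersecting with the inverse set gives a group. It lies in \<open>K\<close> because
    \<open>\<one>\<close> does.\<close>
  define V where "V = ?S \<inter> {g \<in> carrier G. inv g \<in> ?S}"
  have V_iff: "g \<in> V \<longleftrightarrow> g \<in> carrier G \<and> (\<forall>k\<in>K. k \<otimes> g \<in> K) \<and> (\<forall>k\<in>K. k \<otimes> inv g \<in> K)" for g
    by (auto simp: V_def)
  have V: "openin T V"
    unfolding V_def using S openin_preimage[OF continuous_inv S] by blast
  moreover have sV: "subgroup V G"
  proof (rule subgroupI)
    have "\<one> \<in> V" using Kc by (auto simp: V_iff)
    then show "V \<noteq> {}" by blast
    show "inv a \<in> V" if "a \<in> V" for a using that by (simp add: V_iff)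
    show "a \<otimes> b \<in> V" if "a \<in> V" "b \<in> V" for a b
    proof -
      have "a \<in> carrier G" "b \<in> carrier G" using that V_iff by blast+
      moreover have "k \<otimes> a \<otimes> b \<in> K" "k \<otimes> inv b \<otimes> inv a \<in> K" if "k \<in> K" for k
        using that \<open>a \<in> V\<close> \<open>b \<in> V\<close> V_iff by blast+
      ultimately show ?thesis
        using Kc by (auto simp: V_iff inv_mult_group m_assoc subset_eq)
    qed
  qed (auto simp: V_iff)
  moreover have "compactin T V"
  proof (rule closed_compactin[OF K _ closedin_open_subgroup[OF sV V]])
    show "V \<subseteq> K"
    proof
      fix g assume "g \<in> V"
      then have "g \<in> carrier G" "\<one> \<otimes> g \<in> K" using KB(5) unfolding C V_iff by blast+
      then show "g \<in> K" by simp
    qed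
  qed
  ultimately show ?thesis unfolding compact_open_subgroup_def by blast
qed

end

section \<open>Flows of automorphisms and tidiness above\<close>

text \<open>An abstract action of the integers by automorphisms, instantiated later by conjugation
  with powers of \<open>x\<close>. Time reversal is then another instance
  (\<open>reverse_flow\<close>), so statements about the past can be transferred to the
  future.\<close>

locale tdlc_flow = tdlc_group +
  fixes c :: "int \<Rightarrow> 'a \<Rightarrow> 'a"
  assumes flow_closed [simp]: "a \<in> carrier G \<Longrightarrow> c n a \<in> carrier G"
    and flow_mult: "a \<in> carrier G \<Longrightarrow> b \<in> carrier G \<Longrightarrow> c n (a \<otimes> b) = c n a \<otimes> c n b"
    and flow_zero [simp]: "a \<in> carrier G \<Longrightarrow> c 0 a = a"
    and flow_flow [simp]: "a \<in> carrier G \<Longrightarrow> c m (c n a) = c (m + n) a"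
    and flow_continuous: "continuous_map T T (c n)"
begin

lemma reverse_flow: "tdlc_flow G T (\<lambda>n. c (- n))"
  by unfold_locales (auto simp: flow_mult flow_continuous add.commute)

lemma flow_one [simp]: "c n \<one> = \<one>"
proof -
  have "c n \<one> \<otimes> c n \<one> = c n \<one>" using flow_mult[of \<one> \<one> n] by simp
  then show ?thesis by (metis flow_closed l_cancel_one one_closed)
qed

lemma flow_inv: "a \<in> carrier G \<Longrightarrow> c n (inv a) = inv (c n a)"
  using flow_mult[of "inv a" a n] by (simp add: inv_equality)

text \<open>In Willis' notation \<open>fwd V\<close> is \<open>V\<^sub>-\<close>, \<open>bwd V\<close> is \<open>V\<^sub>+\<close>, and \<open>homoclinic V\<close> is
  \<open>V\<^sub>+\<^sub>+ \<inter> V\<^sub>-\<^sub>-\<close>.\<close>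

definition fwd :: "'a set \<Rightarrow> 'a set" where
  "fwd V = {g \<in> carrier G. \<forall>n\<ge>0. c n g \<in> V}"

definition bwd :: "'a set \<Rightarrow> 'a set" where
  "bwd V = {g \<in> carrier G. \<forall>n\<ge>0. c (- n) g \<in> V}"

definition homoclinic :: "'a set \<Rightarrow> 'a set" where
  "homoclinic V = {g \<in> carrier G. \<exists>N. \<forall>n\<ge>N. c n g \<in> V \<and> c (- n) g \<in> V}"

lemma bwd_subset: "bwd V \<subseteq> V" and fwd_subset: "fwd V \<subseteq> V"
  using flow_zero unfolding bwd_def fwd_def by force+

lemma bwd_carrier: "g \<in> bwd V \<Longrightarrow> g \<in> carrier G" and fwd_carrier: "g \<in> fwd V \<Longrightarrow> g \<in> carrier G"
  by (auto simp: bwd_def fwd_def)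

lemma bwdD: "g \<in> bwd V \<Longrightarrow> n \<le> 0 \<Longrightarrow> c n g \<in> V"
  unfolding bwd_def by (metis (no_types, lifting) mem_Collect_eq minus_minus neg_0_le_iff_le)

lemma fwdD: "g \<in> fwd V \<Longrightarrow> 0 \<le> n \<Longrightarrow> c n g \<in> V"
  unfolding fwd_def by blast

lemma flow_bwd: "g \<in> bwd V \<Longrightarrow> n \<le> 0 \<Longrightarrow> c n g \<in> bwd V"
  using bwdD[of g V] by (auto simp: bwd_def)

lemma flow_fwd: "g \<in> fwd V \<Longrightarrow> 0 \<le> n \<Longrightarrow> c n g \<in> fwd V"
  by (auto simp: fwd_def)

lemma subgroup_bwd: assumes "subgroup V G" shows "subgroup (bwd V) G"
proof (rule subgroupI)
  show "bwd V \<noteq> {}" using subgroup.one_closed[OF assms] by (auto simp: bwd_def intro!: exI[of _ \<one>])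
qed (use assms in \<open>auto simp: bwd_def flow_mult flow_inv subgroup.m_closed subgroup.m_inv_closed\<close>)

lemma subgroup_fwd: assumes "subgroup V G" shows "subgroup (fwd V) G"
proof (rule subgroupI)
  show "fwd V \<noteq> {}" using subgroup.one_closed[OF assms] by (auto simp: fwd_def intro!: exI[of _ \<one>])
qed (use assms in \<open>auto simp: fwd_def flow_mult flow_inv subgroup.m_closed subgroup.m_inv_closed\<close>)

lemma subgroup_homoclinic: assumes "subgroup V G" shows "subgroup (homoclinic V) G"
proof (rule subgroupI)
  show "homoclinic V \<noteq> {}"
    using subgroup.one_closed[OF assms] by (auto simp: homoclinic_def intro!: exI[of _ \<one>])
  show "inv a \<in> homoclinic V" if a: "a \<in> homoclinic V" for a
  proof -
    obtain N where "a \<in> carrier G" "\<forall>n\<ge>N. c n a \<in> V \<and> c (- n) a \<in> V"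
      using a by (auto simp: homoclinic_def)
    then have "\<forall>n\<ge>N. c n (inv a) \<in> V \<and> c (- n) (inv a) \<in> V"
      using assms by (simp add: flow_inv subgroup.m_inv_closed)
    then show ?thesis using \<open>a \<in> carrier G\<close> unfolding homoclinic_def by blast
  qed
  show "a \<otimes> b \<in> homoclinic V" if a: "a \<in> homoclinic V" and b: "b \<in> homoclinic V" for a b
  proof -
    obtain M N where "\<forall>n\<ge>M. c n a \<in> V \<and> c (- n) a \<in> V" "\<forall>n\<ge>N. c n b \<in> V \<and> c (- n) b \<in> V"
      using a b by (auto simp: homoclinic_def)
    then have "\<forall>n\<ge>max M N. c n (a \<otimes> b) \<in> V \<and> c (- n) (a \<otimes> b) \<in> V"
      using a b assms by (auto simp: homoclinic_def flow_mult subgroup.m_closed)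
    then show ?thesis using a b unfolding homoclinic_def by blast
  qed
qed (auto simp: homoclinic_def)

lemma flow_homoclinic: assumes "g \<in> homoclinic V" shows "c m g \<in> homoclinic V"
proof -
  obtain N where N: "g \<in> carrier G" "\<forall>n\<ge>N. c n g \<in> V \<and> c (- n) g \<in> V"
    using assms by (auto simp: homoclinic_def)
  have "c n (c m g) \<in> V \<and> c (- n) (c m g) \<in> V" if "n \<ge> N + \<bar>m\<bar>" for n
  proof -
    have "n + m \<ge> N" "n - m \<ge> N" using that by auto
    then have "c (n + m) g \<in> V" "c (- (n - m)) g \<in> V" using N by blast+
    then show ?thesis using N by simp
  qed
  then show ?thesis using N(1) unfolding homoclinic_def by auto
qed

lemma bwd_fwd_subset_homoclinic: "bwd V \<inter> fwd V \<subseteq> homoclinic V"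
  by (auto simp: bwd_def fwd_def homoclinic_def)

lemma closedin_flow_preimage: "closedin T A \<Longrightarrow> closedin T {g \<in> carrier G. c n g \<in> A}"
  by (intro closedin_preimage flow_continuous)

lemma openin_flow_preimage: "openin T A \<Longrightarrow> openin T {g \<in> carrier G. c n g \<in> A}"
  by (intro openin_preimage flow_continuous)

lemma closedin_fwd: assumes "closedin T V" shows "closedin T (fwd V)"
proof -
  have "fwd V = (\<Inter>n\<in>{0..}. {g \<in> carrier G. c n g \<in> V})" by (auto simp: fwd_def)
  then show ?thesis using assms by (auto intro!: closedin_INT closedin_flow_preimage)
qed

lemma closedin_bwd: assumes "closedin T V" shows "closedin T (bwd V)"
proof -
  have "bwd V = (\<Inter>n\<in>{0..}. {g \<in> carrier G. c (- n) g \<in> V})" by (auto simp: bwd_def)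
  then show ?thesis using assms by (auto intro!: closedin_INT closedin_flow_preimage)
qed

lemma compactin_bwd: "compactin T V \<Longrightarrow> compactin T (bwd V)"
  using closedin_bwd bwd_subset closed_compactin compact_imp_closed by metis

text \<open>Inversion exchanges the order of the factors, and \<open>V\<close> as well as both
  factors are subgroups.\<close>

lemma bwd_mult_fwd_commute:
  assumes V: "subgroup V G" "V \<subseteq> bwd V <#> fwd V"
  shows "V \<subseteq> fwd V <#> bwd V"
proof
  fix g assume "g \<in> V"
  then have "inv g \<in> V" "g \<in> carrier G"
    using V(1) by (auto simp: subgroup.m_inv_closed subgroup.mem_carrier)
  then obtain a b where ab: "a \<in> bwd V" "b \<in> fwd V" "inv g = a \<otimes> b"
    using V(2) by (blast elim: set_multE)
  have "g = inv b \<otimes> inv a"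
    using ab \<open>g \<in> carrier G\<close> by (metis bwd_carrier fwd_carrier inv_inv inv_mult_group)
  moreover have "inv b \<in> fwd V" "inv a \<in> bwd V"
    using ab subgroup_bwd subgroup_fwd V(1) subgroup.m_inv_closed by metis+
  ultimately show "g \<in> fwd V <#> bwd V" by (simp add: set_multI)
qed

text \<open>A factorization of every element through one step of the flow propagates to all finite
  numbers of steps, and then to infinitely many by compactness.\<close>
lemma tidy_above_of_one_step:
  assumes W: "compact_open_subgroup W" and step: "W \<subseteq> bwd W <#> {g \<in> W. c 1 g \<in> W}"
  shows "W \<subseteq> bwd W <#> fwd W"
proof
  note cW = compact_open_subgroupD[OF W]
  note sW = subgroup.m_closed[OF cW(1)] subgroup.m_inv_closed[OF cW(1)] subgroup.mem_carrier[OF cW(1)]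
  note sb = subgroup.m_closed[OF subgroup_bwd[OF cW(1)]] subgroup.m_inv_closed[OF subgroup_bwd[OF cW(1)]]
  fix g assume g: "g \<in> W"
  have gc: "g \<in> carrier G" using g sW by blast
  \<comment> \<open>The candidates \<open>p\<close> for the first factor whose cofactor stays in
    \<open>W\<close> up to time \<open>k\<close>.\<close>
  let ?C = "\<lambda>k. {p \<in> bwd W. \<forall>i\<in>{0..int k}. c i (inv p \<otimes> g) \<in> W}"
  have ne: "?C k \<noteq> {}" for k
  proof (induction k)
    case 0
    have "\<one> \<in> ?C 0" using g gc subgroup.one_closed[OF subgroup_bwd[OF cW(1)]] by auto
    then show ?case by blast
  next
    case (Suc k)
    then obtain p where p: "p \<in> bwd W" "\<forall>i\<in>{0..int k}. c i (inv p \<otimes> g) \<in> W" by blast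
    have pc: "p \<in> carrier G" using p bwd_carrier by blast
    have "c (int k) (inv p \<otimes> g) \<in> W" using p(2) by simp
    then obtain a b where ab: "a \<in> bwd W" "b \<in> W" "c 1 b \<in> W" "c (int k) (inv p \<otimes> g) = a \<otimes> b"
      using step by (blast elim: set_multE)
    have abc: "a \<in> carrier G" "b \<in> carrier G" using ab bwd_carrier sW by blast+
    \<comment> \<open>The factor split off at time \<open>k\<close> is pulled back to time 0. The
      new cofactor is \<open>b\<close> at time \<open>k\<close> and \<open>c 1 b\<close> at time
      \<open>k + 1\<close>; earlier times are not spoiled because the orbit of \<open>q\<close> is
      in \<open>W\<close> up to time \<open>k\<close>.\<close>
    define q where "q = c (- int k) a"
    have qc: "q \<in> carrier G" and qb: "q \<in> bwd W"
      using abc flow_bwd[OF ab(1), of "- int k"] by (simp_all add: q_def)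
    have "inv p \<otimes> g = c (- int k) (a \<otimes> b)"
      using pc gc ab(4) flow_flow[of "inv p \<otimes> g" "- int k" "int k"] by (metis add.left_inverse flow_zero inv_closed m_closed)
    then have "inv p \<otimes> g = q \<otimes> c (- int k) b" using abc by (simp add: q_def flow_mult)
    then have e: "inv (p \<otimes> q) \<otimes> g = c (- int k) b"
      using pc qc gc abc by (simp add: inv_mult_group m_assoc)
    have "c i (inv (p \<otimes> q) \<otimes> g) \<in> W" if i: "i \<in> {0..int (Suc k)}" for i
    proof (cases "i \<le> int k")
      case True
      have "inv (p \<otimes> q) \<otimes> g = inv q \<otimes> (inv p \<otimes> g)"
        using pc qc gc by (simp add: inv_mult_group m_assoc)
      then have "c i (inv (p \<otimes> q) \<otimes> g) = inv (c i q) \<otimes> c i (inv p \<otimes> g)"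
        using pc qc gc by (simp add: flow_mult flow_inv)
      moreover have "c i q \<in> W"
        using bwdD[OF ab(1), of "i - int k"] True abc by (simp add: q_def)
      ultimately show ?thesis using p(2) i True sW by simp
    next
      case False
      then have "i = int k + 1" using i by auto
      then show ?thesis using e ab abc by simp
    qed
    moreover have "p \<otimes> q \<in> bwd W" using p qb sb by blast
    ultimately show ?case by blast
  qed
  have "closedin T (?C k)" for k
  proof -
    have "continuous_map T T (\<lambda>p. c i (inv p \<otimes> g))" for i
    proof -
      have "continuous_map T T (\<lambda>p. inv p \<otimes> g)" using gc by (intro continuous_group_intros)
      from continuous_map_compose[OF this flow_continuous] show ?thesis by (simp add: o_def)
    qed
    then have "closedin T {p \<in> carrier G. c i (inv p \<otimes> g) \<in> W}" for i
      using closedin_preimage compact_imp_closed[OF cW(2)] by blast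
    moreover have "?C k = bwd W \<inter> (\<Inter>i\<in>{0..int k}. {p \<in> carrier G. c i (inv p \<otimes> g) \<in> W})"
      using bwd_carrier by auto
    ultimately show ?thesis
      using closedin_bwd[OF compact_imp_closed[OF cW(2)]] by (simp only:, intro closedin_Int closedin_INT) auto
  qed
  moreover have "?C k \<subseteq> bwd W" "?C (Suc k) \<subseteq> ?C k" for k by auto
  ultimately obtain p where p: "\<And>k. p \<in> ?C k"
    using compactin_nested_nonempty[OF compactin_bwd[OF cW(2)], of ?C] ne by blast
  have pb: "p \<in> bwd W" using p by blast
  have "c i (inv p \<otimes> g) \<in> W" if "i \<ge> 0" for i
    using p[of "nat i"] that by auto
  then have "inv p \<otimes> g \<in> fwd W" using pb bwd_carrier gc by (auto simp: fwd_def)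
  then have "p \<otimes> (inv p \<otimes> g) \<in> bwd W <#> fwd W" using pb set_multI by blast
  then show "g \<in> bwd W <#> fwd W" using pb bwd_carrier gc by simp
qed

text \<open>\<open>W\<close> is the intersection of \<open>V\<close> with its first \<open>k\<close>
  translates under the flow. These sets decrease to \<open>bwd V\<close>, so by compactness one of
  them enters the open set where the one-step factorization is available. The last clause serves to
  keep \<open>homoclinic_closure\<close> inside the shrunken group.\<close>

lemma exists_tidy_above:
  assumes V: "compact_open_subgroup V"
  obtains W where "compact_open_subgroup W" "W \<subseteq> V" "W \<subseteq> bwd W <#> fwd W"
    "\<And>S. S \<subseteq> V \<Longrightarrow> (\<And>n s. s \<in> S \<Longrightarrow> c n s \<in> S) \<Longrightarrow> S \<subseteq> W"
proof -
  note cV = compact_open_subgroupD[OF V]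
  note sV = subgroup.m_closed[OF cV(1)] subgroup.m_inv_closed[OF cV(1)] subgroup.mem_carrier[OF cV(1)]
  define A where "A = (\<lambda>k. {g \<in> carrier G. \<forall>i\<in>{0..int k}. c (- i) g \<in> V})"
  have A_INT: "A k = (\<Inter>i\<in>{0..int k}. {g \<in> carrier G. c (- i) g \<in> V})" for k
    unfolding A_def by fastforce
  have A_closed: "closedin T (A k)" for k
    using compact_imp_closed[OF cV(2)] unfolding A_INT
    by (intro closedin_INT closedin_flow_preimage) auto
  have A_open: "openin T (A k)" for k
    unfolding A_INT by (intro openin_INT2 openin_flow_preimage cV(3)) auto
  have A_sub: "A k \<subseteq> V" for k
  proof
    fix g assume "g \<in> A k"
    then have "c (- 0) g \<in> V" "g \<in> carrier G" unfolding A_def by fastforce+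
    then show "g \<in> V" by simp
  qed
  have A_sg: "subgroup (A k) G" for k
  proof (rule subgroupI)
    show "A k \<noteq> {}" using subgroup.one_closed[OF cV(1)] by (auto simp: A_def intro!: exI[of _ \<one>])
  qed (auto simp: A_def flow_mult flow_inv sV)
  have A_cos: "compact_open_subgroup (A k)" for k
    unfolding compact_open_subgroup_def
    using A_sg A_open closed_compactin[OF cV(2) A_sub A_closed] by blast
  \<comment> \<open>An open set around \<open>bwd V\<close>, which is the intersection of all
    \<open>A k\<close>.\<close>
  let ?O = "bwd V <#> {g \<in> carrier G. c 1 g \<in> V}"
  have O: "openin T ?O"
    using bwd_carrier by (intro openin_set_mult openin_flow_preimage cV(3)) auto
  obtain k where k: "A k \<subseteq> ?O"
  proof (rule ccontr)
    assume "\<not> thesis"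
    then have ne: "A k - ?O \<noteq> {}" for k using that by blast
    have "closedin T (A k - ?O)" for k using A_closed O by blast
    moreover have "A (Suc k) \<subseteq> A k" for k by (auto simp: A_def)
    ultimately obtain g where g: "\<And>k. g \<in> A k - ?O"
      using compactin_nested_nonempty[of T V "\<lambda>k. A k - ?O"] cV(2) A_sub ne by blast
    have gc: "g \<in> carrier G" using g A_def by blast
    have "c (- n) g \<in> V" if "n \<ge> 0" for n
      using g[of "nat n"] that by (auto simp: A_def)
    then have "g \<in> bwd V" using gc by (auto simp: bwd_def)
    moreover have "\<one> \<in> {g \<in> carrier G. c 1 g \<in> V}" using subgroup.one_closed[OF cV(1)] by simp
    ultimately have "g \<otimes> \<one> \<in> ?O" by (rule set_multI)
    then show False using g gc by simp
  qed
  \<comment> \<open>Membership in \<open>A k\<close> only restricts the past, and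
    \<open>bwd V\<close> already restricts all of it. Hence the \<open>bwd V\<close> factor supplied
    by \<open>?O\<close> also serves for \<open>A k\<close>.\<close>
  have bw: "bwd (A k) = bwd V"
  proof
    show "bwd (A k) \<subseteq> bwd V" using A_sub by (auto simp: bwd_def)
    show "bwd V \<subseteq> bwd (A k)"
    proof
      fix g assume g: "g \<in> bwd V"
      have "c (- n) g \<in> A k" if "n \<ge> 0" for n
        using g that bwdD[OF g] by (auto simp: A_def bwd_def)
      then show "g \<in> bwd (A k)" using g by (auto simp: bwd_def)
    qed
  qed
  have step: "A k \<subseteq> bwd (A k) <#> {g \<in> A k. c 1 g \<in> A k}"
  proof
    fix g assume g: "g \<in> A k"
    then obtain p q where pq: "p \<in> bwd V" "q \<in> carrier G" "c 1 q \<in> V" "g = p \<otimes> q"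
      using k by (blast elim: set_multE)
    have pA: "p \<in> A k" using pq bw bwd_subset by blast
    have "q = inv p \<otimes> g" using pq bwd_carrier by simp
    then have qA: "q \<in> A k"
      using pA g subgroup.m_closed[OF A_sg] subgroup.m_inv_closed[OF A_sg] by metis
    have "c (- i) (c 1 q) \<in> V" if "i \<in> {0..int k}" for i
    proof (cases "i = 0")
      case True then show ?thesis using pq by simp
    next
      case False
      then have "i - 1 \<in> {0..int k}" using that by simp
      then have "c (- (i - 1)) q \<in> V" using qA unfolding A_def by blast
      then show ?thesis using pq by simp
    qed
    then have "c 1 q \<in> A k" using pq by (simp add: A_def)
    then show "g \<in> bwd (A k) <#> {g \<in> A k. c 1 g \<in> A k}"
      using pq bw qA by (simp add: set_multI)
  qed
  show ?thesis
  proof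
    show "A k \<subseteq> bwd (A k) <#> fwd (A k)" using tidy_above_of_one_step[OF A_cos step] .
    show "S \<subseteq> A k" if "S \<subseteq> V" "\<And>n s. s \<in> S \<Longrightarrow> c n s \<in> S" for S
      using that sV unfolding A_def by blast
  qed (use A_cos A_sub in auto)
qed

end

section \<open>Homoclinic elements and tidy subgroups\<close>

context tdlc_flow
begin

text \<open>Only the finitely many cosets of \<open>bwd W\<close> in \<open>c 1 ` bwd W\<close> met by \<open>homoclinic W\<close>
  matter: their representatives are eventually carried into \<open>W\<close> by the flow, so the
  excursions outside \<open>W\<close> have bounded length.\<close>
lemma homoclinic_relatively_compact:
  assumes W: "compact_open_subgroup W"
  obtains K where "compactin T K" "homoclinic W \<subseteq> K"
proof -
  note cW = compact_open_subgroupD[OF W]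
  let ?D = "homoclinic W"
  note sW = subgroup.m_closed[OF cW(1)] subgroup.m_inv_closed[OF cW(1)] subgroup.mem_carrier[OF cW(1)]
  note sD = subgroup.m_closed[OF subgroup_homoclinic[OF cW(1)]]
    subgroup.m_inv_closed[OF subgroup_homoclinic[OF cW(1)]]
    subgroup.mem_carrier[OF subgroup_homoclinic[OF cW(1)]]
  note sb = subgroup.m_closed[OF subgroup_bwd[OF cW(1)]] subgroup.m_inv_closed[OF subgroup_bwd[OF cW(1)]]
  \<comment> \<open>The homoclinic elements whose orbit lies in \<open>W\<close> at all negative
    times, but perhaps not at time 0.\<close>
  let ?A = "{d \<in> ?D. c (- 1) d \<in> bwd W}"
  have K: "compactin T (c 1 ` W)" using image_compactin[OF cW(2) flow_continuous] .
  have "?A \<subseteq> c 1 ` W"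
  proof
    fix d assume "d \<in> ?A"
    then have "d = c 1 (c (- 1) d)" "c (- 1) d \<in> W" using sD(3) bwd_subset[of W] by auto
    then show "d \<in> c 1 ` W" by blast
  qed
  then obtain F where F: "finite F" "F \<subseteq> ?A" "?A \<subseteq> F <#> W"
    using compactin_cover_cosets[OF K cW(1,3), of ?A] by blast
  have "\<forall>f\<in>F. \<exists>N. \<forall>n\<ge>N. c n f \<in> W" using F(2) unfolding homoclinic_def by blast
  from bchoice[OF this] obtain N0 where N0: "\<forall>f\<in>F. \<forall>n\<ge>N0 f. c n f \<in> W" by blast
  \<comment> \<open>From time \<open>N\<close> on, all representatives are in \<open>W\<close>. The
    inserted 0 guarantees that \<open>Max\<close> is taken over a nonempty set.\<close>
  define N where "N = Max (insert 0 (N0 ` F))"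
  have N: "c n f \<in> W" if "f \<in> F" "n \<ge> N" for f n
  proof -
    have "N0 f \<le> N" unfolding N_def using F(1) that(1) by (intro Max_ge) auto
    then show ?thesis using N0 that by force
  qed
  \<comment> \<open>Induction on how late the orbit leaves \<open>W\<close>. At the exit point
    \<open>e = f \<otimes> w\<close>, the representative \<open>f\<close> is in \<open>W\<close>
    again at time \<open>N + k\<close>, while \<open>w\<close> is in \<open>bwd W\<close> and so
    falls under the claim for \<open>k\<close>.\<close>
  have *: "d \<in> W <#> c N ` bwd W" if "d \<in> ?D" "c (- (N + int k)) d \<in> bwd W" for d k
    using that
  proof (induction k arbitrary: d)
    case 0
    then have "d = \<one> \<otimes> c N (c (- N) d)" "c (- N) d \<in> bwd W" using sD by auto
    then show ?case using subgroup.one_closed[OF cW(1)] by (metis imageI set_multI)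
  next
    case (Suc k)
    define e where "e = c (- (N + int k)) d"
    have dc: "d \<in> carrier G" using Suc sD by blast
    have eD: "e \<in> ?D" unfolding e_def using Suc(2) flow_homoclinic by blast
    have e1: "c (- 1) e \<in> bwd W" using Suc(3) dc by (simp add: e_def algebra_simps)
    then obtain f w where fw: "f \<in> F" "w \<in> W" "e = f \<otimes> w"
      using F(3) eD by (blast elim: set_multE)
    have fA: "f \<in> ?D" "c (- 1) f \<in> bwd W" and fc: "f \<in> carrier G" and wc: "w \<in> carrier G"
      using fw F(2) sW(3) sD(3) by blast+
    have we: "w = inv f \<otimes> e" using fw fc wc by simp
    then have wD: "w \<in> ?D" using fA eD sD by metis
    have "c (- 1) w = inv (c (- 1) f) \<otimes> c (- 1) e"
      using we fc sD(3)[OF eD] by (simp add: flow_mult flow_inv)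
    then have w1: "c (- 1) w \<in> bwd W" using fA e1 sb by metis
    have wb: "w \<in> bwd W"
    proof -
      have "c (- n) w \<in> W" if "n \<ge> 0" for n
      proof (cases "n = 0")
        case True then show ?thesis using fw wc by simp
      next
        case False
        then show ?thesis using bwdD[OF w1, of "- (n - 1)"] that wc by simp
      qed
      then show ?thesis using wc by (simp add: bwd_def)
    qed
    let ?d = "c (N + int k) w"
    have "c (- (N + int k)) ?d \<in> bwd W" using wb wc by simp
    then have "?d \<in> W <#> c N ` bwd W" using Suc(1)[of ?d] flow_homoclinic[OF wD] by blast
    then obtain u v where uv: "u \<in> W" "v \<in> c N ` bwd W" "?d = u \<otimes> v" by (rule set_multE)
    have "d = c (N + int k) e" using dc by (simp add: e_def)
    then have "d = c (N + int k) f \<otimes> ?d" using fw fc wc by (simp add: flow_mult)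
    then have "d = (c (N + int k) f \<otimes> u) \<otimes> v"
      using uv fc sW(3)[OF uv(1)] bwd_carrier by (auto simp: m_assoc)
    moreover have "c (N + int k) f \<otimes> u \<in> W" using N[OF fw(1), of "N + int k"] uv sW by simp
    ultimately show ?case using uv(2) set_multI by metis
  qed
  have "?D \<subseteq> W <#> c N ` bwd W"
  proof
    fix d assume d: "d \<in> ?D"
    then obtain M where M: "\<forall>n\<ge>M. c (- n) d \<in> W" unfolding homoclinic_def by blast
    let ?k = "nat (M - N)"
    have "c (- n) (c (- (N + int ?k)) d) \<in> W" if "n \<ge> 0" for n
    proof -
      have "N + int ?k + n \<ge> M" using that by simp
      then have "c (- (N + int ?k + n)) d \<in> W" using M by blast
      moreover have "c (- n) (c (- (N + int ?k)) d) = c (- (N + int ?k + n)) d"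
        using sD(3)[OF d] by (simp add: algebra_simps)
      ultimately show ?thesis by simp
    qed
    then have "c (- (N + int ?k)) d \<in> bwd W" using sD(3)[OF d] by (simp add: bwd_def)
    then show "d \<in> W <#> c N ` bwd W" using * d by blast
  qed
  moreover have "compactin T (W <#> c N ` bwd W)"
    using compactin_set_mult[OF cW(2) image_compactin[OF compactin_bwd[OF cW(2)] flow_continuous]] .
  ultimately show ?thesis using that by blast
qed

text \<open>The closure is taken because \<open>homoclinic V\<close> need not be closed, while
  limits of homoclinic elements occur in the compactness arguments.\<close>

definition homoclinic_closure :: "'a set \<Rightarrow> 'a set" where
  "homoclinic_closure V = T closure_of homoclinic V"

lemma homoclinic_closure:
  assumes W: "compact_open_subgroup W"
  shows "compactin T (homoclinic_closure W)" "subgroup (homoclinic_closure W) G"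
    "homoclinic W \<subseteq> homoclinic_closure W"
    "g \<in> homoclinic_closure W \<Longrightarrow> c n g \<in> homoclinic_closure W"
proof -
  note cW = compact_open_subgroupD[OF W]
  obtain K where "compactin T K" "homoclinic W \<subseteq> K"
    using homoclinic_relatively_compact[OF W] .
  then show "compactin T (homoclinic_closure W)"
    unfolding homoclinic_closure_def
    using closed_compactin[of T K] compact_imp_closed closure_of_minimal closedin_closure_of by metis
  show "subgroup (homoclinic_closure W) G"
    unfolding homoclinic_closure_def using subgroup_closure_of[OF subgroup_homoclinic[OF cW(1)]] .
  show "homoclinic W \<subseteq> homoclinic_closure W"
    unfolding homoclinic_closure_def
    by (rule closure_of_subset) (auto simp: topspace_carrier homoclinic_def)
  show "c n g \<in> homoclinic_closure W" if "g \<in> homoclinic_closure W"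
  proof -
    have "c n ` homoclinic W \<subseteq> homoclinic W" using flow_homoclinic by blast
    then have "c n ` (T closure_of homoclinic W) \<subseteq> T closure_of homoclinic W"
      by (rule order_trans[OF continuous_map_image_closure_subset[OF flow_continuous] closure_of_mono])
    then show ?thesis using that unfolding homoclinic_closure_def by blast
  qed
qed

text \<open>Two times at which the backward orbit meets the same coset of \<open>W\<close> give an element of
  \<open>homoclinic W\<close> that moves an arbitrarily long piece of the backward orbit of \<open>g\<close> into \<open>fwd W\<close>.\<close>
lemma fwd_bounded_backwards:
  assumes W: "compact_open_subgroup W" and tidy: "W \<subseteq> fwd W <#> bwd W"
    and g: "g \<in> fwd W" and K: "compactin T K" "\<And>n. n \<ge> 0 \<Longrightarrow> c (- n) g \<in> K"
  shows "g \<in> homoclinic_closure W"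
proof -
  note cW = compact_open_subgroupD[OF W]
  let ?D = "homoclinic W" let ?L = "homoclinic_closure W"
  note L = homoclinic_closure[OF W]
  note sW = subgroup.m_closed[OF cW(1)] subgroup.m_inv_closed[OF cW(1)] subgroup.mem_carrier[OF cW(1)]
  note sb = subgroup.m_closed[OF subgroup_bwd[OF cW(1)]] subgroup.m_inv_closed[OF subgroup_bwd[OF cW(1)]]
  note sf = subgroup.m_closed[OF subgroup_fwd[OF cW(1)]] subgroup.m_inv_closed[OF subgroup_fwd[OF cW(1)]]
  note sL = subgroup.m_closed[OF L(2)] subgroup.m_inv_closed[OF L(2)] subgroup.mem_carrier[OF L(2)]
  have gc: "g \<in> carrier G" using g fwd_carrier by blast
  \<comment> \<open>Corrections \<open>l\<close> after which \<open>g \<otimes> l\<close> is in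
    \<open>fwd W\<close> already at time \<open>- j\<close>. An \<open>l\<close> that works for all
    \<open>j\<close> puts \<open>g \<otimes> l\<close> into \<open>bwd W \<inter> fwd W\<close>,
    hence \<open>g\<close> into \<open>?L\<close>.\<close>
  let ?C = "\<lambda>j. {l \<in> ?L. c (- int j) (g \<otimes> l) \<in> fwd W}"
  have ne: "?C j \<noteq> {}" for j
  proof -
    obtain F where F: "finite F" "F \<subseteq> K" "K \<subseteq> F <#> W"
      using compactin_cover_cosets[OF K(1) cW(1,3), of K] by blast
    have Fc: "F \<subseteq> carrier G" using F(2) compactin_subset_carrier[OF K(1)] by blast
    have "\<forall>n. \<exists>f\<in>F. c (- int n) g \<in> f <# W"
    proof
      fix n
      have "c (- int n) g \<in> F <#> W" using K(2) F(3) by auto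
      then show "\<exists>f\<in>F. c (- int n) g \<in> f <# W" by (auto simp: set_mult_def l_coset_def)
    qed
    then obtain r where r: "\<And>n. r n \<in> F" "\<And>n. c (- int n) g \<in> r n <# W" by metis
    have "finite (range r)" using r(1) F(1) by (meson finite_subset image_subsetI)
    then obtain n0 where inf: "infinite {n. r n = r n0}"
      using pigeonhole_infinite[of UNIV r] by auto
    \<comment> \<open>A gap of at least \<open>j\<close> between the two visits is what makes the
      correction reach back to time \<open>- j\<close>.\<close>
    obtain n1 where n1: "n1 \<ge> n0 + j" "r n1 = r n0"
      using infinite_nat_iff_unbounded_le[of "{n. r n = r n0}"] inf by blast
    define i where "i = int n1 - int n0"
    have i: "i \<ge> int j" "i \<ge> 0" using n1 by (auto simp: i_def)
    let ?x = "c (- int n0) g" let ?y = "c (- int n1) g"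
    have xy: "?x \<in> carrier G" "?y \<in> carrier G" using gc by simp_all
    have "inv ?x \<otimes> ?y \<in> W"
    proof -
      have rc: "r n0 \<in> carrier G" using r(1) Fc by blast
      obtain u v where "u \<in> W" "v \<in> W" "?x = r n0 \<otimes> u" "?y = r n0 \<otimes> v"
        using r(2)[of n0] r(2)[of n1] n1(2) by (auto simp: l_coset_def)
      then show ?thesis using rc sW by (simp add: inv_mult_group m_assoc)
    qed
    then obtain a b where ab: "a \<in> fwd W" "b \<in> bwd W" "inv ?x \<otimes> ?y = a \<otimes> b"
      using tidy by (blast elim: set_multE)
    have abc: "a \<in> carrier G" "b \<in> carrier G" using ab bwd_carrier fwd_carrier by blast+
    have "?y = ?x \<otimes> (a \<otimes> b)" using ab(3) xy by (metis inv_mult_cancel(2))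
    then have "?x \<otimes> a = ?y \<otimes> inv b" using xy abc by (simp add: m_assoc)
    then have "c (int n0) (?x \<otimes> a) = c (int n0) (?y \<otimes> inv b)" by simp
    then have eq: "g \<otimes> c (int n0) a = c (- i) g \<otimes> c (int n0) (inv b)"
      using xy abc gc by (simp add: flow_mult i_def)
    \<comment> \<open>\<open>p\<close> is homoclinic: its past is governed by \<open>b\<close> in
      \<open>bwd W\<close>, and by \<open>eq\<close> its future is governed by \<open>g\<close> and
      \<open>a\<close> in \<open>fwd W\<close>. The element of \<open>?C j\<close> is the translate
      \<open>c i p\<close>, because \<open>c (- i) g \<otimes> p\<close> is in \<open>fwd W\<close>
      and \<open>i \<ge> j\<close>.\<close>
    define p where "p = c (int n0) (inv b)"
    have pc: "p \<in> carrier G" using abc by (simp add: p_def)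
    have p_eq: "p = inv (c (- i) g) \<otimes> (g \<otimes> c (int n0) a)"
      using eq gc abc pc by (simp add: p_def)
    have pD: "p \<in> ?D"
    proof -
      have "c n p \<in> W \<and> c (- n) p \<in> W" if n: "n \<ge> i + int n0" for n
      proof
        have "c (int n0 - n) (inv b) \<in> W"
          using bwdD[of "inv b" W "int n0 - n"] sb ab n i by simp
        then show "c (- n) p \<in> W" using abc by (simp add: p_def)
        have "c n p = inv (c (n - i) g) \<otimes> (c n g \<otimes> c (n + int n0) a)"
          unfolding p_eq using gc abc by (simp add: flow_mult flow_inv)
        moreover have "c (n - i) g \<in> W" "c n g \<in> W" "c (n + int n0) a \<in> W"
          using fwdD g ab n i by simp_all
        ultimately show "c n p \<in> W" using sW by simp
      qed
      then show ?thesis using pc unfolding homoclinic_def by blast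
    qed
    have "g \<otimes> c (int n0) a \<in> fwd W" using g flow_fwd[OF ab(1)] sf by simp
    then have "c (- i) g \<otimes> p \<in> fwd W" using eq by (simp add: p_def)
    then have "c (i - int j) (c (- i) g \<otimes> p) \<in> fwd W" using flow_fwd i by simp
    moreover have "c (i - int j) (c (- i) g \<otimes> p) = c (- int j) (g \<otimes> c i p)"
      using gc pc by (simp add: flow_mult algebra_simps)
    moreover have "c i p \<in> ?L" using flow_homoclinic[OF pD] L(3) by blast
    ultimately show ?thesis by auto
  qed
  have "closedin T (?C j)" for j
  proof -
    have "continuous_map T T (\<lambda>l. c (- int j) (g \<otimes> l))"
    proof -
      have "continuous_map T T (\<lambda>l. g \<otimes> l)" using gc by (intro continuous_group_intros)
      from continuous_map_compose[OF this flow_continuous] show ?thesis by (simp add: o_def)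
    qed
    then have "closedin T {l \<in> carrier G. c (- int j) (g \<otimes> l) \<in> fwd W}"
      using closedin_preimage closedin_fwd[OF compact_imp_closed[OF cW(2)]] by blast
    moreover have "?C j = ?L \<inter> {l \<in> carrier G. c (- int j) (g \<otimes> l) \<in> fwd W}"
      using sL(3) by blast
    ultimately show ?thesis using compact_imp_closed[OF L(1)] by (simp add: closedin_Int)
  qed
  moreover have "?C (Suc j) \<subseteq> ?C j" for j
  proof clarify
    fix l assume l: "l \<in> ?L" "c (- int (Suc j)) (g \<otimes> l) \<in> fwd W"
    then have "c 1 (c (- int (Suc j)) (g \<otimes> l)) \<in> fwd W" using flow_fwd by simp
    then show "c (- int j) (g \<otimes> l) \<in> fwd W" using sL(3)[OF l(1)] gc by simp
  qed
  moreover have "?C j \<subseteq> ?L" for j by blast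
  ultimately obtain l where l: "\<And>j. l \<in> ?C j"
    using compactin_nested_nonempty[OF L(1), of ?C] ne by blast
  have lL: "l \<in> ?L" and lc: "l \<in> carrier G" using l sL(3) by blast+
  have "c (- int 0) (g \<otimes> l) \<in> fwd W" using l by blast
  then have "g \<otimes> l \<in> fwd W" using gc lc by simp
  moreover have "c (- n) (g \<otimes> l) \<in> W" if "n \<ge> 0" for n
  proof -
    have "c (- int (nat n)) (g \<otimes> l) \<in> W" using l[of "nat n"] fwd_subset by blast
    then show ?thesis using that by simp
  qed
  ultimately have "g \<otimes> l \<in> bwd W \<inter> fwd W" using gc lc by (simp add: bwd_def)
  then have "g \<otimes> l \<in> ?L" using bwd_fwd_subset_homoclinic L(3) by blast
  then have "(g \<otimes> l) \<otimes> inv l \<in> ?L" using lL sL by blast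
  then show ?thesis using gc lc by (simp add: m_assoc)
qed

lemma reverse_fwd: "tdlc_flow.fwd G (\<lambda>n. c (- n)) V = bwd V"
  and reverse_bwd: "tdlc_flow.bwd G (\<lambda>n. c (- n)) V = fwd V"
  and reverse_homoclinic_closure:
    "tdlc_flow.homoclinic_closure G T (\<lambda>n. c (- n)) V = homoclinic_closure V"
proof -
  interpret rev: tdlc_flow G T "\<lambda>n. c (- n)" by (rule reverse_flow)
  show "rev.fwd V = bwd V" by (simp add: rev.fwd_def bwd_def)
  show "rev.bwd V = fwd V" by (simp add: rev.bwd_def fwd_def)
  have "rev.homoclinic V = homoclinic V" by (auto simp: rev.homoclinic_def homoclinic_def)
  then show "rev.homoclinic_closure V = homoclinic_closure V"
    by (simp add: rev.homoclinic_closure_def homoclinic_closure_def)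
qed

lemma bwd_bounded_forwards:
  assumes "compact_open_subgroup W" "W \<subseteq> bwd W <#> fwd W"
    and "g \<in> bwd W" "compactin T K" "\<And>n. n \<ge> 0 \<Longrightarrow> c n g \<in> K"
  shows "g \<in> homoclinic_closure W"
proof -
  interpret rev: tdlc_flow G T "\<lambda>n. c (- n)" by (rule reverse_flow)
  show ?thesis
    using rev.fwd_bounded_backwards[of W g K] assms
    by (simp add: reverse_fwd reverse_bwd reverse_homoclinic_closure)
qed

text \<open>Write \<open>g = a \<otimes> b\<close> with \<open>a\<close> in \<open>bwd W\<close> and
  \<open>b\<close> in \<open>fwd W\<close>. The past of \<open>b\<close> is bounded because those of
  \<open>a\<close> and \<open>g\<close> are, so \<open>b\<close> is in the closure; as the closure
  is compact and invariant, the future of \<open>a\<close> is then bounded too.\<close>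

lemma bounded_orbit:
  assumes W: "compact_open_subgroup W" and tidy: "W \<subseteq> bwd W <#> fwd W"
    and g: "g \<in> W" and K: "compactin T K" "\<And>n. c n g \<in> K"
  shows "g \<in> homoclinic_closure W"
proof -
  note cW = compact_open_subgroupD[OF W]
  let ?L = "homoclinic_closure W"
  note L = homoclinic_closure[OF W]
  note sW = subgroup.m_closed[OF cW(1)] subgroup.m_inv_closed[OF cW(1)] subgroup.mem_carrier[OF cW(1)]
  note sL = subgroup.m_closed[OF L(2)] subgroup.m_inv_closed[OF L(2)] subgroup.mem_carrier[OF L(2)]
  have gc: "g \<in> carrier G" using g sW by blast
  obtain a b where ab: "a \<in> bwd W" "b \<in> fwd W" "g = a \<otimes> b"
    using g tidy by (blast elim: set_multE)
  have abc: "a \<in> carrier G" "b \<in> carrier G" using ab bwd_carrier fwd_carrier by blast+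
  have bL: "b \<in> ?L"
  proof (rule fwd_bounded_backwards[OF W bwd_mult_fwd_commute[OF cW(1) tidy] ab(2)])
    show "compactin T (W <#> K)" using compactin_set_mult cW K by blast
    show "c (- n) b \<in> W <#> K" if "n \<ge> 0" for n
    proof -
      have "b = inv a \<otimes> g" using ab abc by simp
      then have "c (- n) b = inv (c (- n) a) \<otimes> c (- n) g"
        using abc gc by (simp add: flow_mult flow_inv)
      moreover have "inv (c (- n) a) \<in> W" using bwdD[OF ab(1), of "- n"] that sW by simp
      ultimately show ?thesis using K(2) by (simp add: set_multI)
    qed
  qed
  have "a \<in> ?L"
  proof (rule bwd_bounded_forwards[OF W tidy ab(1)])
    show "compactin T (K <#> ?L)" using compactin_set_mult L K by blast
    show "c n a \<in> K <#> ?L" for n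
    proof -
      have "a = g \<otimes> inv b" using ab abc by (simp add: m_assoc)
      then have "c n a = c n g \<otimes> inv (c n b)" using abc gc by (simp add: flow_mult flow_inv)
      then show ?thesis using K(2) L(4)[OF bL] sL by (simp add: set_multI)
    qed
  qed
  then show ?thesis using ab(3) bL sL by simp
qed

text \<open>The last conjunct stands for tidiness below, often expressed by closedness of the union
  of the translates of \<open>bwd V\<close>. It enters as a ban on returns: see
  \<open>tidy_bwd_return\<close> and \<open>tidy_convex\<close>.\<close>

definition tidy :: "'a set \<Rightarrow> bool" where
  "tidy V \<longleftrightarrow> compact_open_subgroup V \<and> V \<subseteq> bwd V <#> fwd V \<and> homoclinic V \<subseteq> V"

text \<open>Adjoin \<open>homoclinic_closure W\<close> to the largest subgroup of \<open>W\<close> that it normalizes, and make the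
  result tidy above. An element homoclinic to the new group has a bounded orbit and thus
  already lies in \<open>homoclinic_closure W\<close>.\<close>
lemma exists_tidy: "\<exists>V. tidy V"
proof -
  obtain U where U: "compact_open_subgroup U" using exists_compact_open_subgroup by blast
  obtain W where W: "compact_open_subgroup W" "W \<subseteq> bwd W <#> fwd W"
    using exists_tidy_above[OF U] by metis
  note cW = compact_open_subgroupD[OF W(1)]
  let ?L = "homoclinic_closure W"
  note L = homoclinic_closure[OF W(1)]
  note sW = subgroup.m_closed[OF cW(1)] subgroup.m_inv_closed[OF cW(1)] subgroup.mem_carrier[OF cW(1)]
  note sL = subgroup.m_closed[OF L(2)] subgroup.m_inv_closed[OF L(2)] subgroup.mem_carrier[OF L(2)]
  define C where "C = {g \<in> carrier G. \<forall>l\<in>?L. inv l \<otimes> g \<otimes> l \<in> W}"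
  have one_L: "\<one> \<in> ?L" using L(2) subgroup.one_closed by blast
  have C_W: "C \<subseteq> W" using one_L by (force simp: C_def)
  have sC: "subgroup C G"
  proof (rule subgroupI)
    have "\<one> \<in> C" using sL subgroup.one_closed[OF cW(1)] by (auto simp: C_def)
    then show "C \<noteq> {}" by blast
    show "inv a \<in> C" if "a \<in> C" for a
    proof -
      have ac: "a \<in> carrier G" using that C_def by blast
      have "inv l \<otimes> inv a \<otimes> l \<in> W" if l: "l \<in> ?L" for l
      proof -
        have "inv (inv l \<otimes> a \<otimes> l) \<in> W" using \<open>a \<in> C\<close> l sW(2) by (simp add: C_def)
        then show ?thesis using ac sL(3)[OF l] by (simp add: inv_mult_group m_assoc)
      qed
      then show ?thesis using ac by (simp add: C_def)
    qed
    show "a \<otimes> b \<in> C" if ab: "a \<in> C" "b \<in> C" for a b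
    proof -
      have abc: "a \<in> carrier G" "b \<in> carrier G" using ab C_def by blast+
      have "inv l \<otimes> (a \<otimes> b) \<otimes> l \<in> W" if l: "l \<in> ?L" for l
      proof -
        have "(inv l \<otimes> a \<otimes> l) \<otimes> (inv l \<otimes> b \<otimes> l) \<in> W" using ab l sW(1) by (simp add: C_def)
        then show ?thesis using abc sL(3)[OF l] by (simp add: m_assoc)
      qed
      then show ?thesis using abc by (simp add: C_def)
    qed
  qed (auto simp: C_def)
  \<comment> \<open>Conjugation by elements of \<open>W\<close> preserves \<open>W\<close>, so
    finitely many conjugates already cut out \<open>C\<close>; this makes \<open>C\<close>
    open.\<close>
  obtain F where F: "finite F" "F \<subseteq> ?L" "?L \<subseteq> F <#> W"
    using compactin_cover_cosets[OF L(1) cW(1,3), of ?L] by blast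
  have C_F: "C = carrier G \<inter> (\<Inter>f\<in>F. {g \<in> carrier G. inv f \<otimes> g \<otimes> f \<in> W})"
  proof (intro equalityI subsetI)
    fix g assume "g \<in> C" then show "g \<in> carrier G \<inter> (\<Inter>f\<in>F. {g \<in> carrier G. inv f \<otimes> g \<otimes> f \<in> W})"
      using F(2) by (auto simp: C_def)
  next
    fix g assume g: "g \<in> carrier G \<inter> (\<Inter>f\<in>F. {g \<in> carrier G. inv f \<otimes> g \<otimes> f \<in> W})"
    have "inv l \<otimes> g \<otimes> l \<in> W" if l: "l \<in> ?L" for l
    proof -
      obtain f w where fw: "f \<in> F" "w \<in> W" "l = f \<otimes> w" using F(3) l by (blast elim: set_multE)
      have fc: "f \<in> carrier G" "w \<in> carrier G" "g \<in> carrier G"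
        using fw F(2) sL(3) sW(3) g by blast+
      have "inv f \<otimes> g \<otimes> f \<in> W" using g fw by blast
      then have "inv w \<otimes> (inv f \<otimes> g \<otimes> f) \<otimes> w \<in> W"
        using sW(1)[OF sW(1)[OF sW(2)[OF fw(2)]] fw(2)] by blast
      then show ?thesis using fc fw by (simp add: inv_mult_group m_assoc)
    qed
    then show "g \<in> C" using g by (simp add: C_def)
  qed
  have C_cont: "continuous_map T T (\<lambda>g. inv f \<otimes> g \<otimes> f)" if "f \<in> F" for f
    using that F(2) sL by (intro continuous_group_intros) auto
  have C_open: "openin T C"
  proof (cases "F = {}")
    case True
    then have "C = topspace T" using C_F by (simp add: topspace_carrier)
    then show ?thesis by simp
  next
    case False
    then have "openin T (\<Inter>f\<in>F. {g \<in> carrier G. inv f \<otimes> g \<otimes> f \<in> W})"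
      using openin_preimage[OF C_cont cW(3)] F(1) by (intro openin_INT2) auto
    moreover have "openin T (carrier G)" using openin_topspace[of T] by (simp add: topspace_carrier)
    ultimately show ?thesis unfolding C_F by (rule openin_Int[rotated])
  qed
  have C_compact: "compactin T C"
    using closed_compactin[OF cW(2) C_W closedin_open_subgroup[OF sC C_open]] .
  have norm: "l \<otimes> a \<otimes> inv l \<in> C" if l: "l \<in> ?L" and a: "a \<in> C" for l a
  proof -
    have ac: "a \<in> carrier G" "l \<in> carrier G" using a l C_def sL(3) by blast+
    have "inv k \<otimes> (l \<otimes> a \<otimes> inv l) \<otimes> k \<in> W" if k: "k \<in> ?L" for k
    proof -
      have "inv l \<otimes> k \<in> ?L" using l k sL by blast
      then have "inv (inv l \<otimes> k) \<otimes> a \<otimes> (inv l \<otimes> k) \<in> W" using a C_def by blast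
      then show ?thesis using ac sL(3)[OF k] by (simp add: inv_mult_group m_assoc)
    qed
    then show ?thesis using ac by (simp add: C_def)
  qed
  let ?V = "C <#> ?L"
  have Cc: "C \<subseteq> carrier G" by (auto simp: C_def)
  have sV: "subgroup ?V G"
  proof (rule subgroupI)
    show "?V \<subseteq> carrier G" using Cc sL by (auto elim!: set_multE)
    show "?V \<noteq> {}" using set_multI[OF subgroup.one_closed[OF sC] one_L] by blast
    show "inv v \<in> ?V" if v: "v \<in> ?V" for v
    proof -
      obtain a l where al: "a \<in> C" "l \<in> ?L" "v = a \<otimes> l" using v by (rule set_multE)
      have "inv v = (inv l \<otimes> inv a \<otimes> inv (inv l)) \<otimes> inv l"
        using al Cc sL(3)[OF al(2)] by (auto simp: inv_mult_group m_assoc)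
      moreover have "inv l \<otimes> inv a \<otimes> inv (inv l) \<in> C" "inv l \<in> ?L"
        using al norm sL(2) subgroup.m_inv_closed[OF sC] by blast+
      ultimately show ?thesis using set_multI by metis
    qed
    show "v \<otimes> w \<in> ?V" if v: "v \<in> ?V" and w: "w \<in> ?V" for v w
    proof -
      obtain a l where al: "a \<in> C" "l \<in> ?L" "v = a \<otimes> l" using v by (rule set_multE)
      obtain b k where bk: "b \<in> C" "k \<in> ?L" "w = b \<otimes> k" using w by (rule set_multE)
      have "v \<otimes> w = (a \<otimes> (l \<otimes> b \<otimes> inv l)) \<otimes> (l \<otimes> k)"
        using al bk Cc sL(3)[OF al(2)] sL(3)[OF bk(2)] by (auto simp: m_assoc subset_eq)
      moreover have "a \<otimes> (l \<otimes> b \<otimes> inv l) \<in> C" "l \<otimes> k \<in> ?L"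
        using al bk norm sL(1) subgroup.m_closed[OF sC] by blast+
      ultimately show ?thesis using set_multI by metis
    qed
  qed
  have L_V: "?L \<subseteq> ?V"
  proof
    fix l assume l: "l \<in> ?L"
    then have "\<one> \<otimes> l \<in> ?V" using subgroup.one_closed[OF sC] set_multI by blast
    then show "l \<in> ?V" using sL(3)[OF l] by simp
  qed
  have V_open: "openin T ?V"
  proof -
    have "?V = ?V <#> C"
    proof (intro equalityI subsetI)
      fix v assume "v \<in> ?V"
      moreover from this have "v \<otimes> \<one> = v" using subgroup.mem_carrier[OF sV] by simp
      ultimately show "v \<in> ?V <#> C" using subgroup.one_closed[OF sC] set_multI by metis
    next
      fix v assume "v \<in> ?V <#> C"
      then obtain u a where ua: "u \<in> ?V" "a \<in> C" "v = u \<otimes> a" by (rule set_multE)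
      have "a \<otimes> \<one> \<in> ?V" using ua one_L set_multI by blast
      then have "a \<in> ?V" using ua Cc by auto
      then show "v \<in> ?V" using ua subgroup.m_closed[OF sV] by blast
    qed
    then show ?thesis using openin_set_mult[OF _ C_open, of ?V] subgroup.subset[OF sV] by simp
  qed
  have V: "compact_open_subgroup ?V"
    unfolding compact_open_subgroup_def
    using sV V_open compactin_set_mult[OF C_compact L(1)] by blast
  obtain X where X: "compact_open_subgroup X" "X \<subseteq> ?V" "X \<subseteq> bwd X <#> fwd X" "?L \<subseteq> X"
    using exists_tidy_above[OF V] L_V L(4) by metis
  note cX = compact_open_subgroupD[OF X(1)]
  have "homoclinic X \<subseteq> X"
  proof
    fix g assume g: "g \<in> homoclinic X"
    then have gc: "g \<in> carrier G" by (simp add: homoclinic_def)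
    obtain N where N: "\<forall>n\<ge>N. c n g \<in> X \<and> c (- n) g \<in> X" using g by (auto simp: homoclinic_def)
    \<comment> \<open>At time \<open>N\<close> the orbit is in \<open>X\<close>, where it splits
      into a factor \<open>w\<close> in \<open>C\<close> and one in \<open>?L\<close>. The orbit of
      \<open>h\<close> is bounded, since outside finitely many times it lies in \<open>X\<close>;
      hence so is that of \<open>w\<close>, and \<open>bounded_orbit\<close> for the original
      \<open>W\<close> applies. Invariance of \<open>?L\<close> leads back to time 0.\<close>
    define h where "h = c N g"
    have hc: "h \<in> carrier G" using gc by (simp add: h_def)
    let ?K = "X \<union> (\<lambda>n. c n g) ` {- N..N}"
    have K: "compactin T ?K"
    proof (rule compactin_Un[OF cX(2) finite_imp_compactin])
      show "(\<lambda>n. c n g) ` {- N..N} \<subseteq> topspace T" using gc by (auto simp: topspace_carrier)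
    qed simp
    have h_K: "c n h \<in> ?K" for n
    proof -
      have "c (n + N) g \<in> ?K"
      proof (cases "\<bar>n + N\<bar> \<le> N")
        case True
        then have "n + N \<in> {- N..N}" by auto
        then show ?thesis by blast
      next
        case False
        then consider "n + N \<ge> N" | "- (n + N) \<ge> N" by linarith
        then show ?thesis using N by cases (auto dest!: spec[of _ "- (n + N)"] simp: add.commute)
      qed
      then show ?thesis using gc by (simp add: h_def)
    qed
    have "h \<in> ?V" using N X(2) by (auto simp: h_def)
    then obtain w l where wl: "w \<in> C" "l \<in> ?L" "h = w \<otimes> l" by (rule set_multE)
    have wlc: "w \<in> carrier G" "l \<in> carrier G" using wl Cc sL(3) by blast+
    have "w \<in> ?L"
    proof (rule bounded_orbit[OF W])
      show "w \<in> W" using wl C_W by blast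
      show "compactin T (?K <#> ?L)" using compactin_set_mult K L by blast
      show "c n w \<in> ?K <#> ?L" for n
      proof -
        have "w = h \<otimes> inv l" using wl wlc by (simp add: m_assoc)
        then have "c n w = c n h \<otimes> inv (c n l)" using hc wlc by (simp add: flow_mult flow_inv)
        moreover have "inv (c n l) \<in> ?L" using L(4)[OF wl(2)] sL(2) by blast
        ultimately show ?thesis using set_multI[OF h_K[of n]] by metis
      qed
    qed
    then have "h \<in> ?L" using wl sL(1) by blast
    then have "c (- N) h \<in> X" using L(4) X(4) by blast
    then show "g \<in> X" using gc by (simp add: h_def)
  qed
  then show ?thesis using X unfolding tidy_def by blast
qed

end

section \<open>Counting cosets\<close>

text \<open>A transversal for the fibres of \<open>f\<close> is also one for \<open>g\<close>. Used
  to compare coset counts with respect to different subgroups or translates.\<close>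

lemma card_image_eqI:
  assumes "\<And>a b. a \<in> A \<Longrightarrow> b \<in> A \<Longrightarrow> f a = f b \<longleftrightarrow> g a = g b"
  shows "card (f ` A) = card (g ` A)"
proof -
  obtain B where B: "B \<subseteq> A" "inj_on f B" "f ` A = f ` B"
    using subset_image_inj[of "f ` A" f A] by blast
  have "inj_on g B" using B(1,2) assms unfolding inj_on_def by blast
  moreover have "g ` A = g ` B"
  proof
    show "g ` A \<subseteq> g ` B"
    proof
      fix z assume "z \<in> g ` A"
      then obtain a where a: "a \<in> A" "z = g a" by blast
      then obtain b where "b \<in> B" "f a = f b" using B(3) by blast
      then show "z \<in> g ` B" using a B(1) assms by blast
    qed
  qed (use B(1) in blast)
  ultimately show ?thesis using B by (simp add: card_image)
qed

context group
begin

text \<open>\<open>S\<close> need not be a union of cosets. An infinite count reads as 0, so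
  monotonicity in \<open>S\<close> requires finiteness; compactness will provide it.\<close>

definition ncosets :: "'a set \<Rightarrow> 'a set \<Rightarrow> nat" where
  "ncosets S V = card ((\<lambda>s. s <# V) ` S)"

lemma ncosets_le_card:
  assumes "subgroup V G" "finite A" "A \<subseteq> carrier G" "S \<subseteq> A <#> V"
  shows "ncosets S V \<le> card A"
proof -
  have "(\<lambda>s. s <# V) ` S \<subseteq> (\<lambda>a. a <# V) ` A"
  proof clarify
    fix s assume "s \<in> S"
    then obtain a v where av: "a \<in> A" "v \<in> V" "s = a \<otimes> v" using assms(4) by (blast elim: set_multE)
    have "a \<in> carrier G" "v \<in> carrier G" using av assms subgroup.subset by blast+
    then have "a <# V = s <# V" using l_coset_eq_iff[OF assms(1), of a s] av by simp
    then show "s <# V \<in> (\<lambda>a. a <# V) ` A" using av by blast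
  qed
  then have "ncosets S V \<le> card ((\<lambda>a. a <# V) ` A)"
    unfolding ncosets_def using assms(2) by (intro card_mono) auto
  also have "\<dots> \<le> card A" using assms(2) by (rule card_image_le)
  finally show ?thesis .
qed

lemma ncosets_representatives:
  assumes V: "subgroup V G" and S: "S \<subseteq> carrier G" "finite ((\<lambda>s. s <# V) ` S)"
  obtains A where "A \<subseteq> S" "finite A" "card A = ncosets S V" "S \<subseteq> A <#> V" "inj_on (\<lambda>s. s <# V) A"
proof -
  obtain A where A: "A \<subseteq> S" "inj_on (\<lambda>s. s <# V) A" "(\<lambda>s. s <# V) ` S = (\<lambda>s. s <# V) ` A"
    using subset_image_inj[THEN iffD1, OF order_refl[of "(\<lambda>s. s <# V) ` S"]] by metis
  have "finite A" using A S(2) finite_image_iff by metis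
  moreover have "card A = ncosets S V" using A by (simp add: ncosets_def card_image)
  moreover have "S \<subseteq> A <#> V"
  proof
    fix s assume s: "s \<in> S"
    then obtain a where a: "a \<in> A" "s <# V = a <# V" using A(3) by blast
    have "s \<in> a <# V" using lcos_self[OF _ V, of s] s S(1) a(2) by blast
    then show "s \<in> A <#> V" using a(1) by (auto simp: l_coset_def set_mult_def)
  qed
  ultimately show ?thesis using that A by blast
qed

section \<open>Double cosets and the index of a subgroup in its conjugates\<close>

definition dcoset :: "'a set \<Rightarrow> 'a \<Rightarrow> 'a set" where
  "dcoset V y = V <#> (y <# V)"

lemma mem_dcoset: "g \<in> dcoset V y \<longleftrightarrow> (\<exists>a\<in>V. \<exists>b\<in>V. g = a \<otimes> (y \<otimes> b))"
  by (auto simp: dcoset_def set_mult_def l_coset_def)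

lemma dcoset_eq:
  assumes V: "subgroup V G" and y: "y \<in> carrier G" and h: "h \<in> dcoset V y"
  shows "dcoset V h = dcoset V y"
proof -
  note sV = subgroup.m_closed[OF V] subgroup.m_inv_closed[OF V] subgroup.mem_carrier[OF V]
  have *: "dcoset V h \<subseteq> dcoset V y" if h: "h \<in> dcoset V y" and y: "y \<in> carrier G" for h y
  proof
    fix g assume "g \<in> dcoset V h"
    then obtain a b p q where "a \<in> V" "b \<in> V" "p \<in> V" "q \<in> V" "g = a \<otimes> (h \<otimes> b)" "h = p \<otimes> (y \<otimes> q)"
      using h by (auto simp: mem_dcoset)
    then have "g = (a \<otimes> p) \<otimes> (y \<otimes> (q \<otimes> b))" "a \<otimes> p \<in> V" "q \<otimes> b \<in> V"
      using y sV by (simp_all add: m_assoc)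
    then show "g \<in> dcoset V y" by (auto simp: mem_dcoset)
  qed
  obtain a b where ab: "a \<in> V" "b \<in> V" "h = a \<otimes> (y \<otimes> b)" using h by (auto simp: mem_dcoset)
  then have "y = inv a \<otimes> (h \<otimes> inv b)" "inv a \<in> V" "inv b \<in> V" "h \<in> carrier G"
    using y sV by (simp_all add: m_assoc)
  then have "y \<in> dcoset V h" "h \<in> carrier G" by (auto simp: mem_dcoset)
  then show ?thesis using *[OF h y] *[of y h] by blast
qed

lemma inv_mem_dcoset:
  assumes V: "subgroup V G" and y: "y \<in> carrier G" and h: "h \<in> dcoset V y"
  shows "inv h \<in> dcoset V (inv y)"
proof -
  note sV = subgroup.m_inv_closed[OF V] subgroup.mem_carrier[OF V]
  obtain a b where ab: "a \<in> V" "b \<in> V" "h = a \<otimes> (y \<otimes> b)" using h by (auto simp: mem_dcoset)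
  then have "inv h = inv b \<otimes> (inv y \<otimes> inv a)" "inv a \<in> V" "inv b \<in> V"
    using y sV by (simp_all add: inv_mult_group m_assoc)
  then show ?thesis by (auto simp: mem_dcoset)
qed

lemma dcoset_subset_carrier:
  assumes "subgroup V G" "y \<in> carrier G" shows "dcoset V y \<subseteq> carrier G"
  using assms by (auto simp: mem_dcoset subgroup.mem_carrier)

text \<open>The quantity that \<open>group_scale\<close> minimizes over \<open>V\<close>.\<close>

definition displacement_index :: "'a set \<Rightarrow> 'a \<Rightarrow> nat" where
  "displacement_index V x = subgroup_index G (conj_set G x V) (conj_set G x V \<inter> V)"

text \<open>Two elements of the conjugate \<open>K\<close> agree modulo \<open>K \<inter> V\<close>
  exactly if they agree modulo \<open>V\<close>.\<close>

lemma displacement_index_eq_ncosets_conj: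
  assumes V: "subgroup V G" and x: "x \<in> carrier G"
  shows "displacement_index V x = ncosets (conj_set G x V) V"
proof -
  note sV = subgroup.m_closed[OF V] subgroup.m_inv_closed[OF V] subgroup.mem_carrier[OF V]
  let ?K = "conj_set G x V"
  have K: "subgroup ?K G"
  proof (rule subgroupI)
    show "?K \<subseteq> carrier G" using x sV by (auto simp: conj_set_def)
    show "?K \<noteq> {}" using subgroup.one_closed[OF V] by (auto simp: conj_set_def)
    show "inv a \<in> ?K" if a: "a \<in> ?K" for a
    proof -
      obtain v where v: "v \<in> V" "a = x \<otimes> v \<otimes> inv x" using a by (auto simp: conj_set_def)
      then have "inv a = x \<otimes> inv v \<otimes> inv x" using x sV by (simp add: inv_mult_group m_assoc)
      then show ?thesis using v sV by (auto simp: conj_set_def)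
    qed
    show "a \<otimes> b \<in> ?K" if ab: "a \<in> ?K" "b \<in> ?K" for a b
    proof -
      obtain v w where v: "v \<in> V" "w \<in> V" "a = x \<otimes> v \<otimes> inv x" "b = x \<otimes> w \<otimes> inv x"
        using ab by (auto simp: conj_set_def)
      then have "a \<otimes> b = x \<otimes> (v \<otimes> w) \<otimes> inv x" using x sV by (simp add: m_assoc)
      then show ?thesis using v sV by (auto simp: conj_set_def)
    qed
  qed
  have "lcosets\<^bsub>G\<lparr>carrier := ?K\<rparr>\<^esub> (?K \<inter> V) = (\<lambda>k. k <# (?K \<inter> V)) ` ?K"
    by (auto simp: LCOSETS_def)
  moreover have "card ((\<lambda>k. k <# (?K \<inter> V)) ` ?K) = card ((\<lambda>k. k <# V) ` ?K)"
  proof (rule card_image_eqI)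
    fix a b assume ab: "a \<in> ?K" "b \<in> ?K"
    then have "inv a \<otimes> b \<in> ?K" "a \<in> carrier G" "b \<in> carrier G"
      using K by (auto simp: subgroup.m_closed subgroup.m_inv_closed subgroup.mem_carrier)
    then show "a <# (?K \<inter> V) = b <# (?K \<inter> V) \<longleftrightarrow> a <# V = b <# V"
      using l_coset_eq_iff[OF V] l_coset_eq_iff[OF subgroups_Inter_pair[OF K V]] by simp
  qed
  ultimately show ?thesis by (simp add: displacement_index_def subgroup_index_def ncosets_def)
qed

text \<open>Left translation by \<open>inv x\<close> carries the cosets of \<open>x v x^-1\<close>
  to those of \<open>v x^-1\<close>, which make up \<open>V x^-1 V\<close>. In this form the index
  visibly depends only on the double coset of \<open>x\<close>.\<close>

lemma displacement_index_eq_ncosets_dcoset: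
  assumes V: "subgroup V G" and x: "x \<in> carrier G"
  shows "displacement_index V x = ncosets (dcoset V (inv x)) V"
proof -
  note sV = subgroup.m_closed[OF V] subgroup.m_inv_closed[OF V] subgroup.mem_carrier[OF V]
  have "displacement_index V x = card ((\<lambda>v. (x \<otimes> v \<otimes> inv x) <# V) ` V)"
    unfolding displacement_index_eq_ncosets_conj[OF V x]
    by (simp add: ncosets_def conj_set_def image_image)
  also have "\<dots> = card ((\<lambda>v. (v \<otimes> inv x) <# V) ` V)"
  proof (rule card_image_eqI)
    fix a b assume "a \<in> V" "b \<in> V"
    then have c: "a \<in> carrier G" "b \<in> carrier G" using sV by blast+
    have "inv (x \<otimes> a \<otimes> inv x) \<otimes> (x \<otimes> b \<otimes> inv x) = inv (a \<otimes> inv x) \<otimes> (b \<otimes> inv x)"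
      using c x by (simp add: inv_mult_group m_assoc)
    then show "(x \<otimes> a \<otimes> inv x) <# V = (x \<otimes> b \<otimes> inv x) <# V \<longleftrightarrow> (a \<otimes> inv x) <# V = (b \<otimes> inv x) <# V"
      using c x by (simp add: l_coset_eq_iff[OF V])
  qed
  also have "(\<lambda>v. (v \<otimes> inv x) <# V) ` V = (\<lambda>s. s <# V) ` dcoset V (inv x)"
  proof (intro equalityI subsetI)
    fix C assume "C \<in> (\<lambda>v. (v \<otimes> inv x) <# V) ` V"
    then obtain v where v: "v \<in> V" "C = (v \<otimes> inv x) <# V" by blast
    have "v \<otimes> inv x = v \<otimes> (inv x \<otimes> \<one>)" using x by simp
    then have "v \<otimes> inv x \<in> dcoset V (inv x)"
      using v subgroup.one_closed[OF V] unfolding mem_dcoset by blast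
    then show "C \<in> (\<lambda>s. s <# V) ` dcoset V (inv x)" using v by blast
  next
    fix C assume "C \<in> (\<lambda>s. s <# V) ` dcoset V (inv x)"
    then obtain a b where ab: "a \<in> V" "b \<in> V" "C = (a \<otimes> (inv x \<otimes> b)) <# V" by (auto simp: mem_dcoset)
    have c: "a \<in> carrier G" "b \<in> carrier G" using ab sV by blast+
    have "inv (a \<otimes> inv x) \<otimes> (a \<otimes> (inv x \<otimes> b)) = b"
      using c x by (simp add: inv_mult_group m_assoc)
    then have "(a \<otimes> inv x) <# V = C" using c x ab by (simp add: l_coset_eq_iff[OF V])
    then show "C \<in> (\<lambda>v. (v \<otimes> inv x) <# V) ` V" using ab by blast
  qed
  finally show ?thesis by (simp add: ncosets_def)
qed

lemma displacement_index_cong: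
  assumes "subgroup V G" "x \<in> carrier G" "h \<in> dcoset V x"
  shows "displacement_index V h = displacement_index V x"
proof -
  have "h \<in> carrier G" using dcoset_subset_carrier assms by blast
  moreover have "dcoset V (inv h) = dcoset V (inv x)"
    using dcoset_eq[OF assms(1) _ inv_mem_dcoset[OF assms]] assms by simp
  ultimately show ?thesis using assms by (simp add: displacement_index_eq_ncosets_dcoset)
qed

end

section \<open>Submultiplicativity of the index and its dependence on the subgroup\<close>

context topological_group
begin

lemma finite_cosets:
  assumes "compactin T K" "subgroup V G" "openin T V" "A \<subseteq> K"
  shows "finite ((\<lambda>s. s <# V) ` A)"
proof -
  obtain F where F: "finite F" "F \<subseteq> A" "A \<subseteq> F <#> V"
    using compactin_cover_cosets[OF assms] .
  have Ac: "A \<subseteq> carrier G" using assms compactin_subset_carrier by blast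
  have "(\<lambda>s. s <# V) ` A \<subseteq> (\<lambda>s. s <# V) ` F"
  proof clarify
    fix s assume s: "s \<in> A"
    then obtain a v where av: "a \<in> F" "v \<in> V" "s = a \<otimes> v" using F(3) by (blast elim: set_multE)
    have "a \<in> carrier G" "v \<in> carrier G" using av assms(2) F(2) Ac subgroup.subset by blast+
    then have "a <# V = s <# V" using l_coset_eq_iff[OF assms(2), of a s] av by simp
    then show "s <# V \<in> (\<lambda>a. a <# V) ` F" using av by blast
  qed
  then show ?thesis using F(1) finite_subset by blast
qed

lemma compactin_dcoset:
  assumes "compactin T V" "y \<in> carrier G"
  shows "compactin T (dcoset V y)"
proof -
  have "y <# V = {y} <#> V" by (auto simp: l_coset_def set_mult_def)
  moreover have "compactin T {y}" using assms by (simp add: topspace_carrier)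
  ultimately show ?thesis
    unfolding dcoset_def using compactin_set_mult assms(1) by metis
qed

lemma dcoset_representatives:
  assumes V: "compact_open_subgroup V" and x: "x \<in> carrier G"
  obtains A where "A \<subseteq> carrier G" "finite A" "card A = displacement_index V x"
    "dcoset V (inv x) \<subseteq> A <#> V"
proof -
  note cV = compact_open_subgroupD[OF V]
  have "finite ((\<lambda>s. s <# V) ` dcoset V (inv x))"
    using finite_cosets[OF compactin_dcoset[OF cV(2)] cV(1,3)] x by blast
  moreover have c: "dcoset V (inv x) \<subseteq> carrier G" using dcoset_subset_carrier cV x by blast
  ultimately show ?thesis
    using ncosets_representatives[OF cV(1), of "dcoset V (inv x)"] that
      displacement_index_eq_ncosets_dcoset[OF cV(1) x] by (metis order_trans)
qed

text \<open>With representatives \<open>B\<close> for \<open>V y^-1 V\<close> and \<open>A\<close>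
  for \<open>V x^-1 V\<close>, one has
  \<open>V y^-1 x^-1 V \<subseteq> B V x^-1 V \<subseteq> B A V\<close>.\<close>

lemma displacement_index_mult_le:
  assumes V: "compact_open_subgroup V" and x: "x \<in> carrier G" and y: "y \<in> carrier G"
  shows "displacement_index V (x \<otimes> y) \<le> displacement_index V x * displacement_index V y"
proof -
  note cV = compact_open_subgroupD[OF V]
  note sV = subgroup.one_closed[OF cV(1)] subgroup.m_closed[OF cV(1)] subgroup.mem_carrier[OF cV(1)]
  obtain A where A: "A \<subseteq> carrier G" "finite A" "card A = displacement_index V x"
    "dcoset V (inv x) \<subseteq> A <#> V" using dcoset_representatives[OF V x] .
  obtain B where B: "B \<subseteq> carrier G" "finite B" "card B = displacement_index V y"
    "dcoset V (inv y) \<subseteq> B <#> V" using dcoset_representatives[OF V y] .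
  have "dcoset V (inv (x \<otimes> y)) \<subseteq> (B <#> A) <#> V"
  proof
    fix g assume "g \<in> dcoset V (inv (x \<otimes> y))"
    then obtain a b where ab: "a \<in> V" "b \<in> V" "g = a \<otimes> (inv (x \<otimes> y) \<otimes> b)"
      by (auto simp: mem_dcoset)
    have abc: "a \<in> carrier G" "b \<in> carrier G" using ab sV by blast+
    have "a \<otimes> (inv y \<otimes> \<one>) \<in> dcoset V (inv y)" using ab sV unfolding mem_dcoset by blast
    then obtain p u where pu: "p \<in> B" "u \<in> V" "a \<otimes> (inv y \<otimes> \<one>) = p \<otimes> u"
      using B(4) by (blast elim: set_multE)
    have "u \<otimes> (inv x \<otimes> b) \<in> dcoset V (inv x)" using pu ab unfolding mem_dcoset by blast
    then obtain q w where qw: "q \<in> A" "w \<in> V" "u \<otimes> (inv x \<otimes> b) = q \<otimes> w"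
      using A(4) by (blast elim: set_multE)
    have c: "p \<in> carrier G" "q \<in> carrier G" "u \<in> carrier G" "w \<in> carrier G"
      using pu qw A(1) B(1) sV(3) by blast+
    have "g = (a \<otimes> (inv y \<otimes> \<one>)) \<otimes> (inv x \<otimes> b)"
      using ab abc x y by (simp add: inv_mult_group m_assoc)
    also have "\<dots> = p \<otimes> (u \<otimes> (inv x \<otimes> b))" using pu c abc x by (simp add: m_assoc)
    also have "\<dots> = (p \<otimes> q) \<otimes> w" using qw c by (simp add: m_assoc)
    finally show "g \<in> (B <#> A) <#> V" using pu qw by (simp add: set_multI)
  qed
  moreover have BA: "B <#> A = (\<lambda>(p, q). p \<otimes> q) ` (B \<times> A)" by (auto simp: set_mult_def)
  moreover have "finite (B <#> A)" unfolding BA using A B by simp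
  moreover have "B <#> A \<subseteq> carrier G" unfolding BA using A B by auto
  ultimately have "displacement_index V (x \<otimes> y) \<le> card (B <#> A)"
    using ncosets_le_card[OF cV(1)] displacement_index_eq_ncosets_dcoset[OF cV(1), of "x \<otimes> y"] x y by simp
  also have "\<dots> \<le> card (B \<times> A)" unfolding BA using A B by (intro card_image_le) simp
  finally show ?thesis using A B by (simp add: card_cartesian_product mult.commute)
qed

lemma displacement_index_one:
  assumes V: "subgroup V G" shows "displacement_index V \<one> \<le> 1"
proof -
  have "conj_set G \<one> V = V" using subgroup.mem_carrier[OF V] by (force simp: conj_set_def)
  moreover have "V \<subseteq> {\<one>} <#> V" using subgroup.mem_carrier[OF V] by (force simp: set_mult_def)
  ultimately show ?thesis
    using ncosets_le_card[OF V, of "{\<one>}" V] displacement_index_eq_ncosets_conj[OF V, of \<one>] by simp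
qed

lemma displacement_index_pow_le:
  assumes V: "compact_open_subgroup V" and x: "x \<in> carrier G"
  shows "displacement_index V (x [^] (n::nat)) \<le> displacement_index V x ^ n"
proof (induction n)
  case 0
  show ?case using displacement_index_one compact_open_subgroupD[OF V] by simp
next
  case (Suc n)
  have "displacement_index V (x [^] Suc n) \<le> displacement_index V (x [^] n) * displacement_index V x"
    using displacement_index_mult_le[OF V, of "x [^] n" x] x by simp
  also have "\<dots> \<le> displacement_index V x ^ n * displacement_index V x" using Suc by simp
  finally show ?case by (simp add: mult.commute)
qed

text \<open>If \<open>V \<subseteq> E U\<close> and \<open>U V \<subseteq> F V\<close> with
  \<open>E\<close>, \<open>F\<close> finite, then \<open>V x^-1 V \<subseteq> E U x^-1 V \<subseteq>
  E A U V \<subseteq> E A F V\<close>, where \<open>A\<close> represents \<open>U x^-1 U\<close>.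
  The constant is \<open>card E * card F\<close>, the same for all \<open>x\<close>.\<close>

lemma displacement_index_commensurable:
  assumes U: "compact_open_subgroup U" and V: "compact_open_subgroup V"
  obtains C where "\<And>x. x \<in> carrier G \<Longrightarrow> displacement_index V x \<le> C * displacement_index U x"
proof -
  note cV = compact_open_subgroupD[OF V] and cU = compact_open_subgroupD[OF U]
  note sV = subgroup.one_closed[OF cV(1)] subgroup.m_closed[OF cV(1)] subgroup.mem_carrier[OF cV(1)]
  note sU = subgroup.one_closed[OF cU(1)] subgroup.m_closed[OF cU(1)] subgroup.mem_carrier[OF cU(1)]
  obtain E where E: "finite E" "E \<subseteq> V" "V \<subseteq> E <#> U"
    using compactin_cover_cosets[OF cV(2) cU(1,3)] by blast
  have UV: "compactin T (U <#> V)" using compactin_set_mult cU cV by blast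
  obtain F where F: "finite F" "F \<subseteq> U <#> V" "U <#> V \<subseteq> F <#> V"
    using compactin_cover_cosets[OF UV cV(1,3)] by blast
  have Ec: "E \<subseteq> carrier G" using E(2) cV(4) by blast
  have Fc: "F \<subseteq> carrier G" using F(2) compactin_subset_carrier[OF UV] by blast
  have "displacement_index V x \<le> (card E * card F) * displacement_index U x" if x: "x \<in> carrier G" for x
  proof -
    obtain A where A: "A \<subseteq> carrier G" "finite A" "card A = displacement_index U x"
      "dcoset U (inv x) \<subseteq> A <#> U" using dcoset_representatives[OF U x] .
    let ?B = "(\<lambda>(e, a, f). e \<otimes> a \<otimes> f) ` (E \<times> A \<times> F)"
    have "dcoset V (inv x) \<subseteq> ?B <#> V"
    proof
      fix g assume "g \<in> dcoset V (inv x)"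
      then obtain a b where ab: "a \<in> V" "b \<in> V" "g = a \<otimes> (inv x \<otimes> b)" by (auto simp: mem_dcoset)
      then obtain e u where eu: "e \<in> E" "u \<in> U" "a = e \<otimes> u" using E(3) by (blast elim: set_multE)
      have "u \<otimes> (inv x \<otimes> \<one>) \<in> dcoset U (inv x)" using eu sU unfolding mem_dcoset by blast
      then obtain p w where pw: "p \<in> A" "w \<in> U" "u \<otimes> (inv x \<otimes> \<one>) = p \<otimes> w"
        using A(4) by (blast elim: set_multE)
      have "w \<otimes> b \<in> U <#> V" using pw ab set_multI by blast
      then obtain f v where fv: "f \<in> F" "v \<in> V" "w \<otimes> b = f \<otimes> v"
        using F(3) by (blast elim: set_multE)
      have c: "e \<in> carrier G" "u \<in> carrier G" "b \<in> carrier G" "p \<in> carrier G" "w \<in> carrier G"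
        "f \<in> carrier G" "v \<in> carrier G"
        using eu ab pw fv Ec A(1) Fc sU(3) sV(3) by blast+
      have "g = e \<otimes> ((u \<otimes> (inv x \<otimes> \<one>)) \<otimes> b)" using ab eu c x by (simp add: m_assoc)
      also have "\<dots> = e \<otimes> (p \<otimes> (w \<otimes> b))" using pw c by (simp add: m_assoc)
      also have "\<dots> = (e \<otimes> p \<otimes> f) \<otimes> v" using fv c by (simp add: m_assoc)
      finally have "g = (e \<otimes> p \<otimes> f) \<otimes> v" .
      moreover have "e \<otimes> p \<otimes> f \<in> ?B"
        by (rule image_eqI[of _ _ "(e, p, f)"]) (use eu pw fv in auto)
      ultimately show "g \<in> ?B <#> V" using fv(2) set_multI by metis
    qed
    moreover have "?B \<subseteq> carrier G" using Ec A(1) Fc by auto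
    ultimately have "displacement_index V x \<le> card ?B"
      using ncosets_le_card[OF cV(1), of ?B] displacement_index_eq_ncosets_dcoset[OF cV(1) x] E A F by simp
    also have "\<dots> \<le> card (E \<times> A \<times> F)" using E A F by (intro card_image_le) simp
    finally show ?thesis using A by (simp add: card_cartesian_product mult_ac)
  qed
  then show ?thesis using that by blast
qed

end

section \<open>Orbits in tidy subgroups do not return\<close>

context tdlc_flow
begin

lemma tidyD:
  assumes "tidy V"
  shows "compact_open_subgroup V" "V \<subseteq> bwd V <#> fwd V" "V \<subseteq> fwd V <#> bwd V" "homoclinic V \<subseteq> V"
  using assms bwd_mult_fwd_commute[OF compact_open_subgroupD(1)] unfolding tidy_def by blast+

text \<open>Split \<open>c n g = a \<otimes> b\<close>. The \<open>fwd\<close> factor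
  \<open>b\<close> is homoclinic, since \<open>g\<close> and \<open>a\<close> have their pasts in
  \<open>V\<close>; tidiness then keeps its whole orbit in \<open>V\<close>, so \<open>b\<close> is
  in \<open>bwd V\<close> as well.\<close>

lemma tidy_bwd_return:
  assumes V: "tidy V" and g: "g \<in> bwd V" "c n g \<in> V"
  shows "c n g \<in> bwd V"
proof -
  note cV = compact_open_subgroupD[OF tidyD(1)[OF V]]
  note sV = subgroup.m_closed[OF cV(1)] subgroup.m_inv_closed[OF cV(1)] subgroup.mem_carrier[OF cV(1)]
  have gc: "g \<in> carrier G" using g bwd_carrier by blast
  obtain a b where ab: "a \<in> bwd V" "b \<in> fwd V" "c n g = a \<otimes> b"
    using g(2) tidyD(2)[OF V] by (blast elim: set_multE)
  have abc: "a \<in> carrier G" "b \<in> carrier G" using ab bwd_carrier fwd_carrier by blast+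
  have b_eq: "b = inv a \<otimes> c n g" using ab abc by simp
  have "c m b \<in> V \<and> c (- m) b \<in> V" if m: "m \<ge> max 0 n" for m
  proof
    show "c m b \<in> V" using fwdD[OF ab(2)] m by simp
    have "c (- m) b = inv (c (- m) a) \<otimes> c (n - m) g"
      unfolding b_eq using abc gc by (simp add: flow_mult flow_inv)
    then show "c (- m) b \<in> V" using bwdD[OF ab(1), of "- m"] bwdD[OF g(1), of "n - m"] m sV by simp
  qed
  then have "b \<in> homoclinic V" using abc unfolding homoclinic_def by blast
  then have "c m b \<in> V" for m using flow_homoclinic tidyD(4)[OF V] by blast
  then have "b \<in> bwd V" using abc by (simp add: bwd_def)
  then show ?thesis using ab subgroup.m_closed[OF subgroup_bwd[OF cV(1)]] by simp
qed

text \<open>Only the \<open>bwd\<close> factor \<open>a\<close> of \<open>g\<close> could leave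
  \<open>V\<close>. It is in \<open>V\<close> at time \<open>m\<close>, hence in
  \<open>bwd V\<close> there by \<open>tidy_bwd_return\<close>, and so in \<open>V\<close> at all
  earlier times.\<close>

lemma tidy_convex:
  assumes V: "tidy V" and g: "g \<in> V" "c m g \<in> V" and i: "0 \<le> i" "i \<le> m"
  shows "c i g \<in> V"
proof -
  note cV = compact_open_subgroupD[OF tidyD(1)[OF V]]
  note sV = subgroup.m_closed[OF cV(1)] subgroup.m_inv_closed[OF cV(1)] subgroup.mem_carrier[OF cV(1)]
  obtain a b where ab: "a \<in> bwd V" "b \<in> fwd V" "g = a \<otimes> b"
    using g(1) tidyD(2)[OF V] by (blast elim: set_multE)
  have abc: "a \<in> carrier G" "b \<in> carrier G" using ab bwd_carrier fwd_carrier by blast+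
  have b: "c m b \<in> V" "c i b \<in> V" using fwdD[OF ab(2)] i by simp_all
  have "c m a = c m g \<otimes> inv (c m b)" using ab abc by (simp add: flow_mult m_assoc)
  then have "c m a \<in> V" using g b sV by simp
  then have "c m a \<in> bwd V" using tidy_bwd_return[OF V ab(1)] by blast
  then have "c (i - m) (c m a) \<in> V" using bwdD[of "c m a" V "i - m"] i by simp
  then have "c i a \<in> V" using abc by simp
  then show ?thesis using ab abc b sV by (simp add: flow_mult)
qed

text \<open>Representatives at time \<open>k + 1\<close> are products of \<open>c k\<close>-translates of representatives at time 1
  with representatives at time \<open>k\<close>.\<close>
lemma ncosets_flow_bwd:
  assumes V: "tidy V"
  shows "ncosets (c 1 ` bwd V) V ^ k \<le> ncosets (c (int k) ` bwd V) V"
proof -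
  note cV = compact_open_subgroupD[OF tidyD(1)[OF V]]
  note sb = subgroup.m_closed[OF subgroup_bwd[OF cV(1)]] subgroup.m_inv_closed[OF subgroup_bwd[OF cV(1)]]
  let ?q = "\<lambda>s. s <# V"
  have fin: "finite (?q ` c n ` bwd V)" for n
    using finite_cosets[OF image_compactin[OF compactin_bwd[OF cV(2)] flow_continuous] cV(1,3)] by blast
  have car: "c n ` bwd V \<subseteq> carrier G" for n using bwd_carrier by auto
  obtain A where A: "A \<subseteq> c 1 ` bwd V" "finite A" "card A = ncosets (c 1 ` bwd V) V" "inj_on ?q A"
    using ncosets_representatives[OF cV(1) car fin] by metis
  have Ac: "A \<subseteq> carrier G" using A(1) car by blast
  have "\<exists>E. E \<subseteq> c (int k) ` bwd V \<and> finite E \<and> card E = card A ^ k \<and> inj_on ?q E"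
  proof (induction k)
    case 0
    have "c (int 0) \<one> \<in> c (int 0) ` bwd V" using subgroup.one_closed[OF subgroup_bwd[OF cV(1)]] by blast
    then show ?case by (intro exI[of _ "{\<one>}"]) simp
  next
    case (Suc k)
    then obtain E where E: "E \<subseteq> c (int k) ` bwd V" "finite E" "card E = card A ^ k" "inj_on ?q E" by blast
    have Ec: "E \<subseteq> carrier G" using E(1) car by blast
    have E_bwd: "c (- int k) e \<in> bwd V" if e: "e \<in> E" for e
    proof -
      obtain b where b: "b \<in> bwd V" "e = c (int k) b" using E(1) e by blast
      then show ?thesis using bwd_carrier by simp
    qed
    have A_bwd: "c (- 1) a \<in> bwd V" if a: "a \<in> A" for a
    proof -
      obtain b where b: "b \<in> bwd V" "a = c 1 b" using A(1) a by blast
      then show ?thesis using bwd_carrier by simp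
    qed
    let ?f = "\<lambda>(a, e). c (int k) a \<otimes> e"
    have f_bwd: "c (- int (Suc k)) (c (int k) a \<otimes> e) \<in> bwd V" if ae: "a \<in> A" "e \<in> E" for a e
    proof -
      have ec: "e \<in> carrier G" "a \<in> carrier G" using ae Ac Ec by blast+
      have "c (- 1) (c (- int k) e) \<in> bwd V" using flow_bwd[OF E_bwd[OF ae(2)]] by simp
      then have "c (- int (Suc k)) e \<in> bwd V" using ec by (simp add: algebra_simps)
      moreover have "c (- int (Suc k)) (c (int k) a) = c (- 1) a" using ec by simp
      ultimately show ?thesis using A_bwd[OF ae(1)] sb ec by (simp add: flow_mult)
    qed
    \<comment> \<open>Distinct pairs give distinct cosets. The quotient \<open>?g\<close> is in
      \<open>V\<close> and comes from \<open>bwd V\<close>, so \<open>tidy_bwd_return\<close> puts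
      it into \<open>bwd V\<close>; going back \<open>k\<close> steps then shows that
      \<open>a\<close> and \<open>a'\<close> agree modulo \<open>V\<close>.\<close>
    have key: "a = a' \<and> e = e'"
      if ae: "a \<in> A" "e \<in> E" "a' \<in> A" "e' \<in> E" and eq: "?q (c (int k) a \<otimes> e) = ?q (c (int k) a' \<otimes> e')"
      for a e a' e'
    proof -
      have cc: "e \<in> carrier G" "a \<in> carrier G" "e' \<in> carrier G" "a' \<in> carrier G" using ae Ac Ec by blast+
      let ?g = "inv (c (int k) a \<otimes> e)  \<otimes> (c (int k) a' \<otimes> e')"
      have gc: "?g \<in> carrier G" using cc by simp
      have "?g \<in> V" using eq cc by (simp add: l_coset_eq_iff[OF cV(1)])
      moreover have "c (- int (Suc k)) ?g \<in> bwd V"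
        using f_bwd[OF ae(1,2)] f_bwd[OF ae(3,4)] cc sb
        by (simp only: flow_mult[of "inv _"] flow_inv inv_closed flow_closed m_closed)
      moreover have "c (int (Suc k)) (c (- int (Suc k)) ?g) = ?g" using gc by simp
      ultimately have gb: "?g \<in> bwd V" using tidy_bwd_return[OF V] by metis
      have "e \<otimes> ?g \<otimes> inv e' = inv (c (int k) a) \<otimes> c (int k) a'"
        using cc by (simp add: inv_mult_group m_assoc)
      then have "c (- int k) (e \<otimes> ?g \<otimes> inv e') = inv a \<otimes> a'"
        using cc by (simp add: flow_mult flow_inv)
      moreover have "c (- int k) (e \<otimes> ?g \<otimes> inv e') \<in> bwd V"
        using E_bwd[OF ae(2)] E_bwd[OF ae(4)] flow_bwd[OF gb, of "- int k"] sb cc gc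
        by (simp only: flow_mult flow_inv inv_closed m_closed)
      ultimately have "inv a \<otimes> a' \<in> V" using bwd_subset by auto
      then have "?q a = ?q a'" using cc by (simp add: l_coset_eq_iff[OF cV(1)])
      then have a: "a = a'" using A(4) ae by (auto dest: inj_onD)
      have "?g = inv e \<otimes> e'" unfolding a using cc by (simp add: inv_mult_group m_assoc)
      then have "?q e = ?q e'" using \<open>?g \<in> V\<close> cc by (simp add: l_coset_eq_iff[OF cV(1)])
      then show ?thesis using a E(4) ae by (auto dest: inj_onD)
    qed
    have "inj_on ?f (A \<times> E)"
    proof (rule inj_onI, clarify)
      fix a e a' e' assume "a \<in> A" "e \<in> E" "a' \<in> A" "e' \<in> E" "c (int k) a \<otimes> e = c (int k) a' \<otimes> e'"
      then show "a = a' \<and> e = e'" using key[of a e a' e'] by simp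
    qed
    then have "card (?f ` (A \<times> E)) = card A ^ Suc k"
      using E by (simp add: card_image card_cartesian_product)
    moreover have "?f ` (A \<times> E) \<subseteq> c (int (Suc k)) ` bwd V"
    proof clarify
      fix a e assume ae: "a \<in> A" "e \<in> E"
      then have "a \<in> carrier G" "e \<in> carrier G" using Ac Ec by blast+
      then have "c (int k) a \<otimes> e \<in> carrier G" by simp
      then have "c (int k) a \<otimes> e = c (int (Suc k)) (c (- int (Suc k)) (c (int k) a \<otimes> e))" by simp
      then show "c (int k) a \<otimes> e \<in> c (int (Suc k)) ` bwd V" using f_bwd[OF ae] by blast
    qed
    moreover have "inj_on ?q (?f ` (A \<times> E))"
    proof (rule inj_onI, clarify)
      fix a e a' e' assume "a \<in> A" "e \<in> E" "a' \<in> A" "e' \<in> E"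
        "(c (int k) a \<otimes> e) <# V = (c (int k) a' \<otimes> e') <# V"
      then show "c (int k) a \<otimes> e = c (int k) a' \<otimes> e'" using key[of a e a' e'] by simp
    qed
    moreover have "finite (?f ` (A \<times> E))" using A(2) E(2) by blast
    ultimately show ?case by blast
  qed
  then obtain E where E: "E \<subseteq> c (int k) ` bwd V" "finite E" "card E = card A ^ k" "inj_on ?q E" by blast
  have "card A ^ k = card (?q ` E)" using E by (simp add: card_image)
  also have "\<dots> \<le> card (?q ` c (int k) ` bwd V)" using E(1) fin by (intro card_mono) auto
  finally show ?thesis using A(3) by (simp add: ncosets_def)
qed

end

section \<open>Scale and contraction groups on a double coset\<close>

lemma le_of_power_le_const_mult_power:
  fixes Q m C :: nat
  assumes "\<And>k. Q ^ k \<le> C * m ^ k"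
  shows "Q \<le> m"
proof (rule ccontr)
  assume "\<not> Q \<le> m"
  then have Qm: "m < Q" by simp
  show False
  proof (cases "m = 0")
    \<comment> \<open>The exponent must be positive, as \<open>0 ^ 0 = 1\<close>.\<close>
    case True then show False using assms[of 1] Qm by simp
  next
    case False
    then have "1 < real Q / real m" using Qm by simp
    then obtain k where "real C < (real Q / real m) ^ k" using real_arch_pow by blast
    then have "real C * real m ^ k < real Q ^ k" using False by (simp add: power_divide pos_less_divide_eq)
    then have "C * m ^ k < Q ^ k" by (metis of_nat_less_iff of_nat_mult of_nat_power)
    then show False using assms[of k] by simp
  qed
qed

locale tdlc_element = tdlc_group +
  fixes x
  assumes x_closed [simp]: "x \<in> carrier G"
begin

definition conj_pow :: "int \<Rightarrow> 'a \<Rightarrow> 'a" where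
  "conj_pow n g = x [^] n \<otimes> g \<otimes> inv (x [^] n)"

sublocale tdlc_flow G T conj_pow
proof
  show "conj_pow n a \<in> carrier G" if "a \<in> carrier G" for a n
    using that by (simp add: conj_pow_def)
  show "conj_pow n (a \<otimes> b) = conj_pow n a \<otimes> conj_pow n b" if "a \<in> carrier G" "b \<in> carrier G" for a b n
    using that by (simp add: conj_pow_def m_assoc)
  show "conj_pow 0 a = a" if "a \<in> carrier G" for a
    using that by (simp add: conj_pow_def)
  show "conj_pow m (conj_pow n a) = conj_pow (m + n) a" if "a \<in> carrier G" for a m n
    using that by (simp add: conj_pow_def m_assoc inv_mult_group int_pow_mult)
  show "continuous_map T T (conj_pow n)" for n
    unfolding conj_pow_def[abs_def] by (intro continuous_group_intros) simp_all
qed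

lemma pow_mult_conj_pow: "g \<in> carrier G \<Longrightarrow> x [^] (n::int) \<otimes> g = conj_pow n g \<otimes> x [^] n"
  by (simp add: conj_pow_def m_assoc)

lemma mult_pow_conj_pow: "g \<in> carrier G \<Longrightarrow> g \<otimes> x [^] (n::int) = x [^] n \<otimes> conj_pow (- n) g"
  by (simp add: conj_pow_def m_assoc int_pow_neg)

lemma conj_set_pow: "conj_set G (x [^] (n::nat)) V = conj_pow (int n) ` V"
  by (simp add: conj_set_def conj_pow_def int_pow_int)

text \<open>The upper bound is submultiplicativity. For the lower one, conjugation by
  \<open>x\<close> keeps \<open>fwd V\<close> inside \<open>V\<close>, so the cosets in the
  conjugate of \<open>V\<close> are those of the conjugate of \<open>bwd V\<close>, whose number
  grows by \<open>ncosets_flow_bwd\<close>.\<close>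

lemma displacement_index_pow:
  assumes V: "tidy V"
  shows "displacement_index V (x [^] (n::nat)) = displacement_index V x ^ n"
proof (rule antisym)
  note cV = compact_open_subgroupD[OF tidyD(1)[OF V]]
  show "displacement_index V (x [^] n) \<le> displacement_index V x ^ n"
    using displacement_index_pow_le[OF tidyD(1)[OF V]] by simp
  let ?q = "\<lambda>s. s <# V"
  have idx: "displacement_index V (x [^] k) = ncosets (conj_pow (int k) ` V) V" for k :: nat
    using displacement_index_eq_ncosets_conj[OF cV(1), of "x [^] k"] by (simp add: conj_set_pow)
  have "?q ` conj_pow 1 ` V \<subseteq> ?q ` conj_pow 1 ` bwd V"
  proof clarify
    fix g assume "g \<in> V"
    then obtain a b where ab: "a \<in> bwd V" "b \<in> fwd V" "g = a \<otimes> b"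
      using tidyD(2)[OF V] by (blast elim: set_multE)
    have abc: "a \<in> carrier G" "b \<in> carrier G" using ab bwd_carrier fwd_carrier by blast+
    have "inv (conj_pow 1 a) \<otimes> conj_pow 1 g = conj_pow 1 b" using ab abc by (simp add: flow_mult)
    moreover have "conj_pow 1 b \<in> V" using fwdD[OF ab(2)] by simp
    ultimately have "?q (conj_pow 1 a) = ?q (conj_pow 1 g)"
      using abc ab by (simp add: l_coset_eq_iff[OF cV(1)])
    then show "?q (conj_pow 1 g) \<in> ?q ` conj_pow 1 ` bwd V" using ab(1) by (metis imageI)
  qed
  then have eq: "?q ` conj_pow 1 ` V = ?q ` conj_pow 1 ` bwd V"
    by (rule equalityI) (intro image_mono bwd_subset)
  have "displacement_index V x = ncosets (conj_pow 1 ` bwd V) V"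
    using idx[of 1] eq by (simp add: ncosets_def nat_pow_def)
  then have "displacement_index V x ^ n \<le> ncosets (conj_pow (int n) ` bwd V) V"
    using ncosets_flow_bwd[OF V] by simp
  also have "\<dots> \<le> ncosets (conj_pow (int n) ` V) V"
    unfolding ncosets_def
  proof (rule card_mono)
    show "finite (?q ` conj_pow (int n) ` V)"
      using finite_cosets[OF image_compactin[OF cV(2) flow_continuous] cV(1,3)] by blast
  qed (intro image_mono bwd_subset)
  finally show "displacement_index V x ^ n \<le> displacement_index V (x [^] n)" using idx by simp
qed

text \<open>In \<open>h^k h = a' x^(nk) b' a x^n b\<close> split \<open>b' a = p q\<close> with
  \<open>p\<close> in \<open>fwd V\<close> and \<open>q\<close> in \<open>bwd V\<close>. Then
  \<open>p\<close> passes to the left through \<open>x^(nk)\<close> and \<open>q\<close> to the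
  right through \<open>x^n\<close>, both remaining in \<open>V\<close>.\<close>

lemma pow_mem_dcoset:
  assumes V: "tidy V" and h: "h \<in> dcoset V (x [^] int n)"
  shows "h [^] (k::nat) \<in> dcoset V (x [^] int (n * k))"
proof (induction k)
  note cV = compact_open_subgroupD[OF tidyD(1)[OF V]]
  case 0
  have "h [^] (0::nat) = \<one> \<otimes> (x [^] int (n * 0) \<otimes> \<one>)" by simp
  then show ?case using subgroup.one_closed[OF cV(1)] unfolding mem_dcoset by blast
next
  note cV = compact_open_subgroupD[OF tidyD(1)[OF V]]
  note sV = subgroup.m_closed[OF cV(1)] subgroup.mem_carrier[OF cV(1)]
  case (Suc k)
  obtain a b where ab: "a \<in> V" "b \<in> V" "h = a \<otimes> (x [^] int n \<otimes> b)" using h by (auto simp: mem_dcoset)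
  obtain a' b' where ab': "a' \<in> V" "b' \<in> V" "h [^] k = a' \<otimes> (x [^] int (n * k) \<otimes> b')"
    using Suc by (auto simp: mem_dcoset)
  have "b' \<otimes> a \<in> V" using ab ab' sV by blast
  then obtain p q where pq: "p \<in> fwd V" "q \<in> bwd V" "b' \<otimes> a = p \<otimes> q"
    using tidyD(3)[OF V] by (blast elim: set_multE)
  have cc: "a \<in> carrier G" "b \<in> carrier G" "a' \<in> carrier G" "b' \<in> carrier G"
    "p \<in> carrier G" "q \<in> carrier G"
    using ab ab' pq sV(2) bwd_carrier fwd_carrier by blast+
  define y where "y = x [^] int n"
  define z where "z = x [^] int (n * k)"
  have yz: "y \<in> carrier G" "z \<in> carrier G" by (simp_all add: y_def z_def)
  have zy: "x [^] int (n * Suc k) = z \<otimes> y"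
    unfolding y_def z_def by (simp add: int_pow_mult[symmetric] algebra_simps)
  have "h [^] Suc k = a' \<otimes> (z \<otimes> b') \<otimes> (a \<otimes> (y \<otimes> b))"
    using ab ab' by (simp add: y_def z_def)
  also have "\<dots> = a' \<otimes> (z \<otimes> ((b' \<otimes> a) \<otimes> (y \<otimes> b)))" using cc yz by (simp add: m_assoc)
  also have "\<dots> = a' \<otimes> ((z \<otimes> p) \<otimes> ((q \<otimes> y) \<otimes> b))" using cc yz pq by (simp add: m_assoc)
  also have "\<dots> = a' \<otimes> ((conj_pow (int (n * k)) p \<otimes> z) \<otimes> ((y \<otimes> conj_pow (- int n) q) \<otimes> b))"
    using pow_mult_conj_pow[of p "int (n * k)"] mult_pow_conj_pow[of q "int n"] cc
    by (simp add: y_def z_def)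
  also have "\<dots> = (a' \<otimes> conj_pow (int (n * k)) p) \<otimes> (x [^] int (n * Suc k) \<otimes> (conj_pow (- int n) q \<otimes> b))"
    unfolding zy using cc yz by (simp add: m_assoc)
  finally have "h [^] Suc k = (a' \<otimes> conj_pow (int (n * k)) p) \<otimes>
    (x [^] int (n * Suc k) \<otimes> (conj_pow (- int n) q \<otimes> b))" .
  moreover have "a' \<otimes> conj_pow (int (n * k)) p \<in> V" "conj_pow (- int n) q \<otimes> b \<in> V"
    using fwdD[OF pq(1), of "int (n * k)"] bwdD[OF pq(2), of "- int n"] ab ab' sV(1) by simp_all
  ultimately show ?case unfolding mem_dcoset by blast
qed

text \<open>The minimum is attained at \<open>V\<close> itself. With \<open>n = 1\<close> and
  \<open>h = x\<close> the lemma also evaluates the scale of \<open>x\<close>.\<close>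

lemma group_scale_dcoset:
  assumes V: "tidy V" and h: "h \<in> dcoset V (x [^] int n)"
  shows "group_scale G T h = displacement_index V x ^ n"
proof -
  note cV = compact_open_subgroupD[OF tidyD(1)[OF V]]
  have hc: "h \<in> carrier G" using dcoset_subset_carrier[OF cV(1)] h by (meson int_pow_closed subsetD x_closed)
  have idx: "displacement_index V (h [^] k) = displacement_index V x ^ (n * k)" for k :: nat
    using displacement_index_cong[OF cV(1) _ pow_mem_dcoset[OF V h, of k]] displacement_index_pow[OF V]
    by (simp add: int_pow_int del: of_nat_mult)
  have "displacement_index V x ^ n \<le> displacement_index U h" if U: "compact_open_subgroup U" for U
  proof -
    obtain C where C: "\<And>y. y \<in> carrier G \<Longrightarrow> displacement_index V y \<le> C * displacement_index U y"
      using displacement_index_commensurable[OF U tidyD(1)[OF V]] by blast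
    have "(displacement_index V x ^ n) ^ k \<le> C * displacement_index U h ^ k" for k
    proof -
      have "(displacement_index V x ^ n) ^ k = displacement_index V (h [^] k)"
        by (simp add: idx power_mult)
      also have "\<dots> \<le> C * displacement_index U (h [^] k)" using C hc by simp
      also have "\<dots> \<le> C * displacement_index U h ^ k"
        using displacement_index_pow_le[OF U hc] by (rule mult_left_mono) simp
      finally show ?thesis .
    qed
    then show ?thesis by (rule le_of_power_le_const_mult_power)
  qed
  moreover have "displacement_index V h = displacement_index V x ^ n" using idx[of 1] hc by simp
  ultimately show ?thesis
    unfolding group_scale_def using tidyD(1)[OF V]
    by (intro Least_equality) (auto simp: displacement_index_def compact_open_subgroup_def)
qed

end

section \<open>Contraction groups under powers and bounded perturbations\<close>

context topological_group
begin

text \<open>Conjugation sends \<open>K \<times> {\<one>}\<close> to \<open>\<one>\<close>, so the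
  tube lemma makes it small uniformly over \<open>K\<close>.\<close>

lemma limitin_conj_compact:
  assumes K: "compactin T K" and a: "\<And>k::nat. a k \<in> K" and g: "limitin T g \<one> sequentially"
  shows "limitin T (\<lambda>k. a k \<otimes> g k \<otimes> inv (a k)) \<one> sequentially"
  unfolding limitin_def
proof (intro conjI allI impI)
  show "\<one> \<in> topspace T" by (simp add: topspace_carrier)
  fix U assume U: "openin T U \<and> \<one> \<in> U"
  let ?f = "\<lambda>p. fst p \<otimes> snd p \<otimes> inv (fst p)"
  let ?W = "{p \<in> topspace (prod_topology T T). ?f p \<in> U}"
  have "continuous_map (prod_topology T T) T ?f"
    by (intro continuous_map_mult continuous_map_inv continuous_map_fst continuous_map_snd)
  then have "openin (prod_topology T T) ?W" using openin_continuous_map_preimage U by blast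
  moreover have "K \<times> {\<one>} \<subseteq> ?W"
    using U compactin_subset_carrier[OF K] by (auto simp: topspace_carrier)
  ultimately obtain A B where AB: "openin T A" "openin T B" "K \<subseteq> A" "\<one> \<in> B" "A \<times> B \<subseteq> ?W"
    using tube_lemma_left[of T T ?W K \<one>] K by (auto simp: topspace_carrier)
  have "\<forall>\<^sub>F k in sequentially. g k \<in> B" using g AB unfolding limitin_def by blast
  then show "\<forall>\<^sub>F k in sequentially. a k \<otimes> g k \<otimes> inv (a k) \<in> U"
  proof (rule eventually_mono)
    fix k assume "g k \<in> B"
    then have "(a k, g k) \<in> ?W" using AB a by blast
    then show "a k \<otimes> g k \<otimes> inv (a k) \<in> U" by simp
  qed
qed

text \<open>One inclusion passes to a subsequence. For the other, write \<open>m\<close> as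
  \<open>n * (m div n) + m mod n\<close>: the remainders contribute conjugators from the finite set
  of \<open>x^j\<close> with \<open>j < n\<close>.\<close>

lemma con_pow:
  assumes x: "x \<in> carrier G" and n: "n \<ge> 1"
  shows "con G T (x [^] (n::nat)) = con G T x"
proof
  have pow: "(x [^] n) [^] (k::nat) = x [^] (n * k)" for k using x by (simp add: nat_pow_pow)
  show "con G T x \<subseteq> con G T (x [^] n)"
  proof
    fix g assume g: "g \<in> con G T x"
    have "strict_mono (\<lambda>k. n * k)" using n by (auto simp: strict_mono_def)
    then show "g \<in> con G T (x [^] n)"
      using g limitin_subsequence[of "\<lambda>k. n * k" T "\<lambda>k. x [^] k \<otimes> g \<otimes> inv (x [^] k)" \<one>]
      by (simp add: con_def pow o_def)
  qed
  show "con G T (x [^] n) \<subseteq> con G T x"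
  proof
    fix g assume g: "g \<in> con G T (x [^] n)"
    then have gc: "g \<in> carrier G" by (simp add: con_def)
    let ?u = "\<lambda>k. x [^] (n * k) \<otimes> g \<otimes> inv (x [^] (n * k))"
    have u: "limitin T ?u \<one> sequentially" using g by (simp add: con_def pow)
    have "filterlim (\<lambda>m. m div n) at_top sequentially"
      unfolding filterlim_at_top
    proof
      fix Z
      show "\<forall>\<^sub>F m in sequentially. Z \<le> m div n"
        using n by (intro eventually_sequentiallyI[of "Z * n"]) (simp add: less_eq_div_iff_mult_less_eq)
    qed
    then have "limitin T (\<lambda>m. ?u (m div n)) \<one> sequentially"
      using u unfolding limitin_def by (auto dest!: filterlim_cong eventually_compose_filterlim)
    then have "limitin T (\<lambda>m. x [^] (m mod n) \<otimes> ?u (m div n) \<otimes> inv (x [^] (m mod n))) \<one> sequentially"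
    proof (rule limitin_conj_compact[rotated 2])
      show "compactin T ((\<lambda>j. x [^] j) ` {..<n})"
        by (rule finite_imp_compactin) (use x in \<open>auto simp: topspace_carrier\<close>)
      show "x [^] (k mod n) \<in> (\<lambda>j. x [^] j) ` {..<n}" for k using n by auto
    qed
    moreover have "x [^] (m mod n) \<otimes> ?u (m div n) \<otimes> inv (x [^] (m mod n)) = x [^] m \<otimes> g \<otimes> inv (x [^] m)" for m
    proof -
      have "x [^] m = x [^] (m mod n) \<otimes> x [^] (n * (m div n))"
        using x by (simp add: nat_pow_mult)
      then show ?thesis using x gc by (simp add: inv_mult_group m_assoc)
    qed
    ultimately show "g \<in> con G T x" using gc by (simp add: con_def)
  qed
qed

text \<open>Conjugating \<open>t g t^-1\<close> by \<open>h^k\<close> is conjugating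
  \<open>g\<close> by \<open>y^k\<close> and then by the bounded factor \<open>h^k t y^-k\<close>;
  so the two sequences tend to \<open>\<one>\<close> together.\<close>

lemma con_conj:
  assumes h: "h \<in> carrier G" and y: "y \<in> carrier G" and t: "t \<in> carrier G" and K: "compactin T K"
    and htK: "\<And>k::nat. h [^] k \<otimes> t \<otimes> inv (y [^] k) \<in> K"
  shows "con G T h = conj_set G t (con G T y)"
proof -
  let ?a = "\<lambda>k. h [^] k \<otimes> t \<otimes> inv (y [^] k)"
  have K': "compactin T ((\<lambda>g. inv g) ` K)" using image_compactin[OF K continuous_inv] .
  have iff: "t \<otimes> g \<otimes> inv t \<in> con G T h \<longleftrightarrow> g \<in> con G T y" if g: "g \<in> carrier G" for g
  proof -
    let ?u = "\<lambda>k::nat. y [^] k \<otimes> g \<otimes> inv (y [^] k)"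
    let ?v = "\<lambda>k::nat. h [^] k \<otimes> (t \<otimes> g \<otimes> inv t) \<otimes> inv (h [^] k)"
    have v: "?v = (\<lambda>k. ?a k \<otimes> ?u k \<otimes> inv (?a k))"
      using h y t g by (simp add: inv_mult_group m_assoc)
    have u: "?u = (\<lambda>k. inv (?a k) \<otimes> ?v k \<otimes> inv (inv (?a k)))"
      using h y t g by (simp add: inv_mult_group m_assoc)
    have "limitin T ?v \<one> sequentially" if "limitin T ?u \<one> sequentially"
      unfolding v by (rule limitin_conj_compact[OF K htK that])
    moreover have "limitin T ?u \<one> sequentially" if v1: "limitin T ?v \<one> sequentially"
    proof -
      have "limitin T (\<lambda>k. inv (?a k) \<otimes> ?v k \<otimes> inv (inv (?a k))) \<one> sequentially"
        by (rule limitin_conj_compact[OF K' _ v1]) (use htK in blast)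
      then show ?thesis using u by simp
    qed
    ultimately show ?thesis using g t by (auto simp: con_def)
  qed
  show ?thesis
  proof (intro equalityI subsetI)
    fix g assume g: "g \<in> con G T h"
    then have gc: "g \<in> carrier G" by (simp add: con_def)
    have e: "g = t \<otimes> (inv t \<otimes> g \<otimes> t) \<otimes> inv t" using gc t by (simp add: m_assoc)
    then have "inv t \<otimes> g \<otimes> t \<in> con G T y" using iff[of "inv t \<otimes> g \<otimes> t"] g gc t by simp
    then show "g \<in> conj_set G t (con G T y)" using e unfolding conj_set_def by blast
  next
    fix g assume "g \<in> conj_set G t (con G T y)"
    then show "g \<in> con G T h" using iff by (auto simp: conj_set_def con_def)
  qed
qed

end

context tdlc_element
begin

text \<open>The sets of \<open>t\<close> that work up to time \<open>k\<close> decrease with \<open>k\<close>, so compactness yields a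
  single \<open>t\<close> for all times.\<close>
lemma exists_shadowing:
  assumes V: "tidy V" and h: "h \<in> dcoset V (x [^] int n)"
  obtains t where "t \<in> V" "\<And>k::nat. h [^] k \<otimes> t \<otimes> inv (x [^] int (n * k)) \<in> V"
proof -
  note cV = compact_open_subgroupD[OF tidyD(1)[OF V]]
  note sV = subgroup.m_closed[OF cV(1)] subgroup.m_inv_closed[OF cV(1)] subgroup.mem_carrier[OF cV(1)]
  have hc: "h \<in> carrier G" using dcoset_subset_carrier[OF cV(1)] h by (meson int_pow_closed subsetD x_closed)
  let ?C = "\<lambda>k::nat. {t \<in> V. h [^] k \<otimes> t \<otimes> inv (x [^] int (n * k)) \<in> V}"
  \<comment> \<open>Not automatic: it excludes that a \<open>t\<close> fails at time
    \<open>k\<close> and works again at time \<open>k + 1\<close>.\<close>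
  have dc: "?C (Suc k) \<subseteq> ?C k" for k
  proof clarify
    fix t assume t: "t \<in> V" and ht: "h [^] Suc k \<otimes> t \<otimes> inv (x [^] int (n * Suc k)) \<in> V"
    have tc: "t \<in> carrier G" using t sV by blast
    obtain a b where ab: "a \<in> V" "b \<in> V" "h = a \<otimes> (x [^] int n \<otimes> b)" using h by (auto simp: mem_dcoset)
    obtain a' b0 where ab0: "a' \<in> V" "b0 \<in> V" "h [^] k = a' \<otimes> (x [^] int (n * k) \<otimes> b0)"
      using pow_mem_dcoset[OF V h, of k] by (auto simp: mem_dcoset)
    define b' where "b' = b0 \<otimes> t"
    have b': "b' \<in> V" using ab0 t sV(1) by (simp add: b'_def)
    have "b \<otimes> a' \<in> V" using ab ab0 sV(1) by blast
    then obtain p q where pq: "p \<in> fwd V" "q \<in> bwd V" "b \<otimes> a' = p \<otimes> q"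
      using tidyD(3)[OF V] by (blast elim: set_multE)
    have cc: "a \<in> carrier G" "b \<in> carrier G" "a' \<in> carrier G" "b0 \<in> carrier G" "b' \<in> carrier G"
      "p \<in> carrier G" "q \<in> carrier G"
      using ab ab0 b' pq sV(3) bwd_carrier fwd_carrier by blast+
    define y where "y = x [^] int n"
    define z where "z = x [^] int (n * k)"
    have yz: "y \<in> carrier G" "z \<in> carrier G" by (simp_all add: y_def z_def)
    have yz_pow: "x [^] int (n * Suc k) = y \<otimes> z"
      unfolding y_def z_def by (simp add: int_pow_mult[symmetric] algebra_simps)
    have hk: "h [^] k \<otimes> t = a' \<otimes> (z \<otimes> b')" using ab0 cc yz tc by (simp add: b'_def z_def m_assoc)
    define w where "w = conj_pow (- int (n * k)) q \<otimes> b'"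
    have wV: "w \<in> V" using bwdD[OF pq(2), of "- int (n * k)"] b' sV(1) by (simp add: w_def)
    have wc: "w \<in> carrier G" using wV sV by blast
    have "h [^] Suc k \<otimes> t = h \<otimes> (h [^] k \<otimes> t)"
      using nat_pow_Suc2[OF hc, of k] hc tc by (simp add: m_assoc)
    also have "\<dots> = a \<otimes> (y \<otimes> ((b \<otimes> a') \<otimes> (z \<otimes> b')))"
      unfolding hk using ab cc yz by (simp add: y_def m_assoc)
    also have "\<dots> = a \<otimes> ((y \<otimes> p) \<otimes> ((q \<otimes> z) \<otimes> b'))" unfolding pq(3) using cc yz by (simp add: m_assoc)
    also have "\<dots> = a \<otimes> ((conj_pow (int n) p \<otimes> y) \<otimes> ((z \<otimes> conj_pow (- int (n * k)) q) \<otimes> b'))"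
      using pow_mult_conj_pow[of p "int n"] mult_pow_conj_pow[of q "int (n * k)"] cc
      by (simp add: y_def z_def)
    also have "\<dots> = (a \<otimes> conj_pow (int n) p) \<otimes> (x [^] int (n * Suc k) \<otimes> w)"
      unfolding yz_pow w_def using cc yz by (simp add: m_assoc)
    also have "\<dots> = (a \<otimes> conj_pow (int n) p) \<otimes> (conj_pow (int (n * Suc k)) w \<otimes> x [^] int (n * Suc k))"
      using pow_mult_conj_pow[OF wc] by simp
    finally have "h [^] Suc k \<otimes> t \<otimes> inv (x [^] int (n * Suc k))
        = (a \<otimes> conj_pow (int n) p) \<otimes> conj_pow (int (n * Suc k)) w"
      using cc wc by (simp add: m_assoc)
    then have *: "(a \<otimes> conj_pow (int n) p) \<otimes> conj_pow (int (n * Suc k)) w \<in> V" using ht by simp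
    have ap: "a \<otimes> conj_pow (int n) p \<in> V" using fwdD[OF pq(1), of "int n"] ab sV(1) by simp
    have "inv (a \<otimes> conj_pow (int n) p) \<otimes> ((a \<otimes> conj_pow (int n) p) \<otimes> conj_pow (int (n * Suc k)) w) \<in> V"
      using sV(1)[OF sV(2)[OF ap] *] .
    then have "conj_pow (int (n * Suc k)) w \<in> V" using cc wc by simp
    \<comment> \<open>Convexity is applied to \<open>w\<close>, which is in \<open>V\<close> at time
      0 and at time \<open>n * Suc k\<close>.\<close>
    then have "conj_pow (int (n * k)) w \<in> V"
      by (rule tidy_convex[OF V wV]) simp_all
    then have "q \<otimes> conj_pow (int (n * k)) b' \<in> V" using cc by (simp add: w_def flow_mult)
    moreover have qV: "q \<in> V" using pq bwd_subset by blast
    ultimately have "inv q \<otimes> (q \<otimes> conj_pow (int (n * k)) b') \<in> V" using sV(1,2) by blast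
    then have "conj_pow (int (n * k)) b' \<in> V" using cc by simp
    then have "a' \<otimes> conj_pow (int (n * k)) b' \<in> V" using ab0 sV(1) by blast
    moreover have "h [^] k \<otimes> t \<otimes> inv z = a' \<otimes> conj_pow (int (n * k)) b'"
      unfolding hk using cc yz by (simp add: conj_pow_def z_def m_assoc)
    ultimately show "h [^] k \<otimes> t \<otimes> inv (x [^] int (n * k)) \<in> V" by (simp add: z_def)
  qed
  have ne: "?C k \<noteq> {}" for k
  proof -
    obtain a b where ab: "a \<in> V" "b \<in> V" "h [^] k = a \<otimes> (x [^] int (n * k) \<otimes> b)"
      using pow_mem_dcoset[OF V h, of k] by (auto simp: mem_dcoset)
    have "h [^] k \<otimes> inv b \<otimes> inv (x [^] int (n * k)) = a"
      using ab sV(3) by (simp add: m_assoc)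
    then have "inv b \<in> ?C k" using ab sV(2) by simp
    then show ?thesis by blast
  qed
  have "closedin T (?C k)" for k
  proof -
    have "continuous_map T T (\<lambda>t. h [^] k \<otimes> t \<otimes> inv (x [^] int (n * k)))"
      by (intro continuous_group_intros nat_pow_closed int_pow_closed inv_closed hc x_closed)
    then have "closedin T {t \<in> carrier G. h [^] k \<otimes> t \<otimes> inv (x [^] int (n * k)) \<in> V}"
      using closedin_preimage compact_imp_closed[OF cV(2)] by blast
    moreover have "?C k = V \<inter> {t \<in> carrier G. h [^] k \<otimes> t \<otimes> inv (x [^] int (n * k)) \<in> V}"
      using sV(3) by blast
    ultimately show ?thesis using compact_imp_closed[OF cV(2)] by (simp add: closedin_Int)
  qed
  moreover have "?C k \<subseteq> V" for k by blast
  ultimately obtain t where "\<And>k. t \<in> ?C k"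
    using compactin_nested_nonempty[OF cV(2), of ?C] ne dc by blast
  then show ?thesis using that by blast
qed

lemma con_dcoset:
  assumes V: "tidy V" and h: "h \<in> dcoset V (x [^] int n)" and n: "n \<ge> 1"
  shows "\<exists>t\<in>carrier G. con G T h = conj_set G t (con G T x)"
proof -
  note cV = compact_open_subgroupD[OF tidyD(1)[OF V]]
  have hc: "h \<in> carrier G" using dcoset_subset_carrier[OF cV(1)] h by (meson int_pow_closed subsetD x_closed)
  obtain t where t: "t \<in> V" "\<And>k::nat. h [^] k \<otimes> t \<otimes> inv (x [^] int (n * k)) \<in> V"
    using exists_shadowing[OF V h] by blast
  have "con G T h = conj_set G t (con G T (x [^] n))"
  proof (rule con_conj[OF hc _ _ cV(2)])
    show "h [^] k \<otimes> t \<otimes> inv ((x [^] n) [^] k) \<in> V" for k :: nat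
      using t(2)[of k] by (simp add: nat_pow_pow int_pow_int del: of_nat_mult)
  qed (use t cV(4) in auto)
  then show ?thesis using con_pow[OF x_closed n] t cV(4) by auto
qed

end

section \<open>Recurrence on the coset space\<close>

context topological_group
begin

lemma topspace_coset_topology: "topspace (coset_topology G T H) = lcosets H"
  using quotient_imp_surjective_map[OF quotient_map_coset_topology[of H]]
  by (auto simp: topspace_carrier LCOSETS_def)

text \<open>The preimage in the group is \<open>U H\<close>. It is reached through inverses, as
  \<open>H U^-1\<close>, since \<open>openin_set_mult\<close> expects the open factor on the
  right.\<close>

lemma openin_coset_image:
  assumes H: "subgroup H G" and U: "openin T U"
  shows "openin (coset_topology G T H) ((\<lambda>u. u <# H) ` U)"
proof -
  note sH = subgroup.m_inv_closed[OF H] subgroup.mem_carrier[OF H]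
  have Uc: "U \<subseteq> carrier G" using openin_subset_carrier U by blast
  let ?U' = "{g \<in> carrier G. inv g \<in> U}"
  have "openin T (H <#> ?U')"
    using openin_set_mult[OF subgroup.subset[OF H]] openin_preimage[OF continuous_inv U] by blast
  then have "openin T {g \<in> carrier G. inv g \<in> H <#> ?U'}" by (rule openin_preimage[OF continuous_inv])
  moreover have "{g \<in> carrier G. inv g \<in> H <#> ?U'} = {g \<in> carrier G. g <# H \<in> (\<lambda>u. u <# H) ` U}"
  proof (intro equalityI subsetI)
    fix g assume g: "g \<in> {g \<in> carrier G. inv g \<in> H <#> ?U'}"
    then obtain h u where hu: "h \<in> H" "u \<in> carrier G" "inv u \<in> U" "inv g = h \<otimes> u"
      by (auto elim!: set_multE)
    have hc: "h \<in> carrier G" "g \<in> carrier G" using hu sH g by blast+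
    have "g = inv (h \<otimes> u)" using hu(4) hc by (metis inv_inv)
    then have "inv (inv u) \<otimes> g = inv h" using hu hc by (simp add: inv_mult_group)
    then have "inv u <# H = g <# H" using hu hc sH by (simp add: l_coset_eq_iff[OF H])
    then show "g \<in> {g \<in> carrier G. g <# H \<in> (\<lambda>u. u <# H) ` U}" using hu hc by (metis (mono_tags, lifting) imageI mem_Collect_eq)
  next
    fix g assume "g \<in> {g \<in> carrier G. g <# H \<in> (\<lambda>u. u <# H) ` U}"
    then obtain u where gu: "g \<in> carrier G" "u \<in> U" "g <# H = u <# H" by blast
    have uc: "u \<in> carrier G" using gu Uc by blast
    have "inv g \<otimes> u \<in> H" using gu uc by (simp add: l_coset_eq_iff[OF H])
    moreover have "inv u \<in> ?U'" using gu uc by simp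
    ultimately have "(inv g \<otimes> u) \<otimes> inv u \<in> H <#> ?U'" by (rule set_multI)
    then show "g \<in> {g \<in> carrier G. inv g \<in> H <#> ?U'}" using gu uc by (simp add: m_assoc)
  qed
  moreover have "(\<lambda>u. u <# H) ` U \<subseteq> lcosets H" using Uc by (auto simp: LCOSETS_def)
  ultimately show ?thesis by (simp add: openin_coset_topology)
qed

lemma finite_covolume_recurrence:
  assumes H: "subgroup H G" and fin: "finite_covolume G T H"
    and V: "subgroup V G" "openin T V" and x: "x \<in> carrier G"
  obtains n :: nat and h where "n \<ge> 1" "h \<in> H" "h \<in> dcoset V (x [^] int n)"
proof -
  note sV = subgroup.m_closed[OF V(1)] subgroup.m_inv_closed[OF V(1)] subgroup.mem_carrier[OF V(1)]
  let ?X = "coset_topology G T H"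
  obtain \<mu> where \<mu>: "radon_measure ?X \<mu>"
    and inv: "\<And>g A. g \<in> carrier G \<Longrightarrow> A \<in> sets \<mu> \<Longrightarrow> emeasure \<mu> ((\<lambda>C. g <# C) ` A) = emeasure \<mu> A"
    and pos: "emeasure \<mu> (space \<mu>) \<noteq> 0" and finm: "emeasure \<mu> (space \<mu>) < \<infinity>"
    using fin unfolding finite_covolume_def by blast
  have Pow: "{U. openin ?X U} \<subseteq> Pow (topspace ?X)" using openin_subset by blast
  have sets_\<mu>: "sets \<mu> = sigma_sets (topspace ?X) {U. openin ?X U}"
    using \<mu> Pow by (simp add: radon_measure_def borel_of_def)
  have space_\<mu>: "space \<mu> = topspace ?X"
    using \<mu> Pow sets_eq_imp_space_eq[of \<mu> "borel_of ?X"] by (simp add: radon_measure_def borel_of_def)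
  have open_sets: "U \<in> sets \<mu>" if "openin ?X U" for U
    using that by (simp add: sets_\<mu> sigma_sets.Basic)
  define A where "A = (\<lambda>g. (\<lambda>u. u <# H) ` (g <# V))"
  have A_open: "openin ?X (A g)" if "g \<in> carrier G" for g
    unfolding A_def using openin_coset_image[OF H openin_l_coset[OF that V(2)]] .
  have A_translate: "A g = (\<lambda>C. g <# C) ` A \<one>" if g: "g \<in> carrier G" for g
  proof -
    have "A g = (\<lambda>v. (g \<otimes> v) <# H) ` V" by (auto simp: A_def l_coset_def)
    also have "\<dots> = (\<lambda>v. g <# (v <# H)) ` V"
      using g sV(3) subgroup.subset[OF H] by (intro image_cong) (simp_all add: lcos_m_assoc)
    also have "\<dots> = (\<lambda>C. g <# C) ` (\<lambda>v. v <# H) ` V" by (simp add: image_image)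
    also have "V = \<one> <# V" using subgroup.subset[OF V(1)] by (simp add: lcos_mult_one)
    finally show ?thesis by (simp add: A_def)
  qed
  have A_measure: "emeasure \<mu> (A g) = emeasure \<mu> (A \<one>)" if "g \<in> carrier G" for g
    using inv[OF that open_sets[OF A_open[OF one_closed]]] A_translate[OF that] by simp
  have A_self: "g <# H \<in> A g" if "g \<in> carrier G" for g
    unfolding A_def using lcos_self[OF that V(1)] by blast
  \<comment> \<open>If \<open>A \<one>\<close> were null, so would be each compact set, being
    covered by finitely many translates; inner regularity on the whole space would then give total
    measure 0.\<close>
  have A_pos: "emeasure \<mu> (A \<one>) \<noteq> 0"
  proof
    assume null: "emeasure \<mu> (A \<one>) = 0"
    have "emeasure \<mu> K = 0" if K: "compactin ?X K" for K
    proof -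
      have "K \<subseteq> \<Union>(A ` carrier G)"
        using compactin_subset_topspace[OF K] A_self unfolding topspace_coset_topology LCOSETS_def by blast
      then obtain \<F> where \<F>: "finite \<F>" "\<F> \<subseteq> A ` carrier G" "K \<subseteq> \<Union>\<F>"
        using compactinD[OF K, of "A ` carrier G"] A_open by blast
      then have "S \<in> null_sets \<mu>" if "S \<in> \<F>" for S
        using that A_measure null open_sets A_open by (auto simp: null_sets_def)
      then have "\<Union>\<F> \<in> null_sets \<mu>"
        using \<F>(1) null_sets.finite_UN[of \<F> "\<lambda>S. S" \<mu>] by auto
      then show ?thesis using \<F>(3) emeasure_mono[of K "\<Union>\<F>" \<mu>] by (auto simp: null_sets_def)
    qed
    then have "(SUP K \<in> {K. compactin ?X K \<and> K \<subseteq> topspace ?X}. emeasure \<mu> K) = 0"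
      by (intro antisym SUP_least) auto
    then show False using \<mu> pos openin_topspace[of ?X] unfolding radon_measure_def space_\<mu> by metis
  qed
  interpret finite_measure \<mu> by (rule finite_measureI) (use finm in simp)
  let ?B = "\<lambda>i::nat. A (x [^] i)"
  \<comment> \<open>Infinitely many disjoint sets of equal positive measure do not fit into finite
    measure.\<close>
  have "\<not> disjoint_family ?B"
  proof
    assume "disjoint_family ?B"
    then have "(\<lambda>i. measure \<mu> (?B i)) sums measure \<mu> (\<Union>i. ?B i)"
      using open_sets A_open x by (intro finite_measure_UNION) auto
    moreover have "measure \<mu> (?B i) = measure \<mu> (A \<one>)" for i
      using A_measure[of "x [^] i"] x by (simp add: measure_def)
    ultimately have "summable (\<lambda>i::nat. measure \<mu> (A \<one>))" by (simp add: sums_iff)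
    then have "measure \<mu> (A \<one>) = 0" by (simp add: summable_const_iff)
    then show False using A_pos by (simp add: emeasure_eq_measure)
  qed
  then obtain i j where ij: "i < j" "?B i \<inter> ?B j \<noteq> {}"
    unfolding disjoint_family_on_def by (metis Int_commute linorder_neqE_nat)
  then obtain v w where vw: "v \<in> V" "w \<in> V" "(x [^] i \<otimes> v) <# H = (x [^] j \<otimes> w) <# H"
    by (auto simp: A_def l_coset_def)
  have vwc: "v \<in> carrier G" "w \<in> carrier G" using vw sV by blast+
  \<comment> \<open>Equality of the two cosets says that this element is in \<open>H\<close>, and it
    simplifies to \<open>v^-1 x^(j-i) w\<close>.\<close>
  let ?h = "inv (x [^] i \<otimes> v) \<otimes> (x [^] j \<otimes> w)"
  have "?h \<in> H" using vw vwc x by (simp add: l_coset_eq_iff[OF H])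
  moreover have "?h \<in> dcoset V (x [^] int (j - i))"
  proof -
    have "x [^] j = x [^] i \<otimes> x [^] (j - i)" using ij(1) x by (simp add: nat_pow_mult)
    then have "?h = inv v \<otimes> (x [^] int (j - i) \<otimes> w)"
      using vwc x by (simp add: inv_mult_group m_assoc int_pow_int)
    then show ?thesis using vw sV(2) unfolding mem_dcoset by blast
  qed
  moreover have "j - i \<ge> 1" using ij(1) by simp
  ultimately show ?thesis using that by blast
qed

end

theorem theorem2p5:
  fixes G :: "('a, 'b) monoid_scheme" and T :: "'a topology" and H :: "'a set"
  assumes "tdlc_group G T"
    and "subgroup H G" and "closedin T H"
    and "finite_covolume G T H"
  shows "\<forall>x \<in> carrier G. \<exists>n::nat. \<exists>h \<in> H. n \<ge> 1 \<and>
           group_scale G T x ^ n = group_scale G T h \<and>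
           (\<exists>g \<in> carrier G. con G T h = conj_set G g (con G T x))"
proof
  fix x assume x: "x \<in> carrier G"
  interpret tdlc_group G T by fact
  interpret tdlc_element G T x by unfold_locales (rule x)
  obtain V where V: "tidy V" using exists_tidy by blast
  note cV = compact_open_subgroupD[OF tidyD(1)[OF V]]
  obtain n h where nh: "n \<ge> 1" "h \<in> H" "h \<in> dcoset V (x [^]\<^bsub>G\<^esub> int n)"
    using finite_covolume_recurrence[OF assms(2,4) cV(1,3) x] .
  have "x = \<one>\<^bsub>G\<^esub> \<otimes>\<^bsub>G\<^esub> (x [^]\<^bsub>G\<^esub> int 1 \<otimes>\<^bsub>G\<^esub> \<one>\<^bsub>G\<^esub>)" by simp
  then have "x \<in> dcoset V (x [^]\<^bsub>G\<^esub> int 1)"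
    using subgroup.one_closed[OF cV(1)] unfolding mem_dcoset by blast
  then have "group_scale G T x ^ n = group_scale G T h"
    using group_scale_dcoset[OF V nh(3)] group_scale_dcoset[OF V, of x 1] by simp
  then show "\<exists>n::nat. \<exists>h \<in> H. n \<ge> 1 \<and>
           group_scale G T x ^ n = group_scale G T h \<and>
           (\<exists>g \<in> carrier G. con G T h = conj_set G g (con G T x))"
    using con_dcoset[OF V nh(3,1)] nh(1,2) by blast
qed

end
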